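(* Let $\varphi,\psi\in\mathbb H$ be Hausdorff functions. Assume that there exists a constant $C>0$ such that for every $\varepsilon>0$, $$\psi(2\varepsilon)\le C\cdot\varphi(\varepsilon).$$ Then there exists a compact product $K\subset E$ with equilibrium state $\mu$ such that $$\overline{D}^{\varphi}_\mu\cdot\mathcal H^{\varphi}(X)=\mu(X)=\underline{D}^{\psi}_\mu\cdot\mathcal P^{\psi}(X)$$ for every Borel subset $X\subset K$. In particular, $$\overline{D}^{\varphi}_\mu\cdot\mathcal H^{\varphi}(K)=1=\underline{D}^{\psi}_\mu\cdot\mathcal P^{\psi}(K).$$
   Context: $\mathbb H$ is the set of Hausdorff functions: continuous non-decreasing functions $\phi:[0,\infty)\to[0,\infty)$ with $\phi(0)=0$ and $\phi>0$ on $(0,\infty)$. Hausdorff and packing measures. Let $(X,d)$ be a metric space and $\phi\in\mathbb H$. All balls are open balls $B=B(x,r)$ with center $x\in X$ and prescribed radius $|B|=r>0$. An $\varepsilon$-cover of $X$ is a countable collection of open balls of radii at most $\varepsilon$ whose union contains $X$; an $\varepsilon$-pack of $X$ is a countable collection of pairwise disjoint open balls of $X$ of radii at most $\varepsilon$. Set $\mathcal H^\phi_\varepsilon(X)=\inf\{\sum_{i}\phi(|B_i|):(B_i)_i\text{ an }\varepsilon\text{-cover of }X\}$ and $\mathcal H^\phi(X)=\lim_{\varepsilon\to0}\mathcal H^\phi_\varepsilon(X)$ ($\phi$-Hausdorff measure); $\mathcal P^\phi_\varepsilon(X)=\sup\{\sum_{i}\phi(|B_i|):(B_i)_i\text{ an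 }\varepsilon\text{-pack of }X\}$, $\mathcal P^\phi_0(X)=\lim_{\varepsilon\to0}\mathcal P^\phi_\varepsilon(X)$, and $\mathcal P^\phi(X)=\inf\{\sum_{n\ge1}\mathcal P^\phi_0(E_n):X=\bigcup_{n\ge1}E_n\}$ ($\phi$-packing measure). For a subset of a metric space, these quantities are computed by regarding the subset as a metric space with the restricted metric. The space $E$. $E=(\mathbb N^* )^{\mathbb N^*}$ is the set of sequences $\underline x=(x_n)_{n\ge1}$ of positive integers, with the ultrametric $\delta(\underline x,\underline x')=2^{-\chi(\underline x,\underline x')}$, where $\chi(\underline x,\underline x')=\inf\{n\ge1:x_n\ne x'_n\}$ (and $\delta(\underline x,\underline x)=0$). A compact product is a compact subset $K\subset E$ of the form $K=\prod_{k\ge1}\{1,\dots,n_k\}$ with $n_k$ positive integers, endowed with the restriction of $\delta$. Its equilibrium state is the product probability measure $\mu=\otimes_{k\ge1}\mu_k$, where $\mu_k$ is the uniform probability measure on $\{1,\dots,n_k\}$. Densities. For a Borel measure $\mu$ on a metric space and $\phi\in\mathbb H$, $\underline D^\phi_\mu(x)=\liminf_{\varepsilon\to0}\mu(B(x,\varepsilon))/\phi(\varepsilon)$ and $\overline D^\phi_\mu(x)=\limsup_{\varepsilon\to0}\mu(B(x,\varepsilon))/\phi(\varepsilon)$. For the equilibrium state $\mu$ of a compact product $K$, the mass of a ball centered in $K$ depends only on its radius, so these densities are constant on $K$; $\underline D^\phi_\mu$ and $\overline D^\phi_\mu$ denote these constants. *)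

theory Defs
  imports "HOL-Probability.Probability"
begin

(* Only the values on [0,\<infinity>) matter. *)
definition hausdorff_functions :: "(real \<Rightarrow> real) set" where
  "hausdorff_functions =
     {\<phi>. continuous_on {0..} \<phi> \<and> mono_on {0..} \<phi> \<and> \<phi> 0 = 0 \<and> (\<forall>t>0. \<phi> t > 0)}"

context Metric_space
begin

(* A countable collection of balls is a countable set of pairs (centre, radius): a ball is
   prescribed together with its radius, which the underlying point set need not determine. *)

definition eps_covers :: "real \<Rightarrow> ('a \<times> real) set set" where
  "eps_covers \<epsilon> = {S. countable S \<and> S \<subseteq> M \<times> {0<..\<epsilon>} \<and> M \<subseteq> (\<Union>(x, r)\<in>S. mball x r)}"

definition eps_packs :: "real \<Rightarrow> ('a \<times> real) set set" where
  "eps_packs \<epsilon> =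
     {S. countable S \<and> S \<subseteq> M \<times> {0<..\<epsilon>} \<and> disjoint_family_on (\<lambda>(x, r). mball x r) S}"

definition hausdorff_content :: "(real \<Rightarrow> real) \<Rightarrow> real \<Rightarrow> ennreal" where
  "hausdorff_content \<phi> \<epsilon> = (INF S\<in>eps_covers \<epsilon>. \<Sum>\<^sub>\<infinity>(x, r)\<in>S. ennreal (\<phi> r))"

definition hausdorff_measure :: "(real \<Rightarrow> real) \<Rightarrow> ennreal" where
  "hausdorff_measure \<phi> = Lim (at_right 0) (hausdorff_content \<phi>)"

definition packing_content :: "(real \<Rightarrow> real) \<Rightarrow> real \<Rightarrow> ennreal" where
  "packing_content \<phi> \<epsilon> = (SUP S\<in>eps_packs \<epsilon>. \<Sum>\<^sub>\<infinity>(x, r)\<in>S. ennreal (\<phi> r))"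

definition packing_premeasure :: "(real \<Rightarrow> real) \<Rightarrow> ennreal" where
  "packing_premeasure \<phi> = Lim (at_right 0) (packing_content \<phi>)"

definition packing_measure :: "(real \<Rightarrow> real) \<Rightarrow> ennreal" where
  "packing_measure \<phi> =
     (INF A\<in>{A :: nat \<Rightarrow> 'a set. M = (\<Union>n. A n)}.
        \<Sum>n. Metric_space.packing_premeasure (A n) d \<phi>)"

definition borel_subsets :: "'a set set" where
  "borel_subsets = sigma_sets M {U. openin mtopology U}"

definition lower_density :: "'a measure \<Rightarrow> (real \<Rightarrow> real) \<Rightarrow> 'a \<Rightarrow> ennreal" where
  "lower_density \<mu> \<phi> x = Liminf (at_right 0) (\<lambda>\<epsilon>. emeasure \<mu> (mball x \<epsilon>) / ennreal (\<phi> \<epsilon>))"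

definition upper_density :: "'a measure \<Rightarrow> (real \<Rightarrow> real) \<Rightarrow> 'a \<Rightarrow> ennreal" where
  "upper_density \<mu> \<phi> x = Limsup (at_right 0) (\<lambda>\<epsilon>. emeasure \<mu> (mball x \<epsilon>) / ennreal (\<phi> \<epsilon>))"

end

lemma antimono_on_tendsto_at_right_0:
  fixes f :: "real \<Rightarrow> ennreal"
  assumes "antimono_on {0<..} f"
  shows "(f \<longlongrightarrow> (SUP \<epsilon>\<in>{0<..}. f \<epsilon>)) (at_right 0)"
proof (rule order_tendstoI)
  fix a assume "a < (SUP \<epsilon>\<in>{0<..}. f \<epsilon>)"
  then obtain e where e: "e > 0" "a < f e"
    by (auto simp: less_SUP_iff)
  have "a < f x" if "0 < x" "x < e" for x
    using monotone_onD[OF assms, of x e] that e by (auto intro: less_le_trans)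
  then show "eventually (\<lambda>x. a < f x) (at_right 0)"
    using e(1) by (auto simp: eventually_at_right_field)
next
  fix a assume a: "(SUP \<epsilon>\<in>{0<..}. f \<epsilon>) < a"
  have "f x < a" if "0 < x" for x
    using a that by (meson SUP_upper greaterThan_iff le_less_trans)
  then show "eventually (\<lambda>x. f x < a) (at_right 0)"
    by (auto simp: eventually_at_right_field intro!: exI[of _ 1])
qed

lemma mono_on_tendsto_at_right_0:
  fixes f :: "real \<Rightarrow> ennreal"
  assumes "mono_on {0<..} f"
  shows "(f \<longlongrightarrow> (INF \<epsilon>\<in>{0<..}. f \<epsilon>)) (at_right 0)"
proof (rule order_tendstoI)
  fix a assume "(INF \<epsilon>\<in>{0<..}. f \<epsilon>) < a"
  then obtain e where e: "e > 0" "f e < a"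
    by (auto simp: INF_less_iff)
  have "f x < a" if "0 < x" "x < e" for x
    using monotone_onD[OF assms, of x e] that e by (auto intro: le_less_trans)
  then show "eventually (\<lambda>x. f x < a) (at_right 0)"
    using e(1) by (auto simp: eventually_at_right_field)
next
  fix a assume a: "a < (INF \<epsilon>\<in>{0<..}. f \<epsilon>)"
  have "a < f x" if "0 < x" for x
    using a that by (meson INF_lower greaterThan_iff less_le_trans)
  then show "eventually (\<lambda>x. a < f x) (at_right 0)"
    by (auto simp: eventually_at_right_field intro!: exI[of _ 1])
qed

context Metric_space
begin

lemma tendsto_hausdorff_measure:
  "(hausdorff_content \<phi> \<longlongrightarrow> hausdorff_measure \<phi>) (at_right 0)"
proof -
  have "antimono_on {0<..} (hausdorff_content \<phi>)"
    unfolding hausdorff_content_def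
    by (intro monotone_onI INF_superset_mono) (fastforce simp: eps_covers_def)+
  from antimono_on_tendsto_at_right_0[OF this] show ?thesis
    unfolding hausdorff_measure_def by (simp add: tendsto_Lim)
qed

lemma tendsto_packing_premeasure:
  "(packing_content \<phi> \<longlongrightarrow> packing_premeasure \<phi>) (at_right 0)"
proof -
  have "mono_on {0<..} (packing_content \<phi>)"
    unfolding packing_content_def
    by (intro monotone_onI SUP_subset_mono) (fastforce simp: eps_packs_def)+
  from mono_on_tendsto_at_right_0[OF this] show ?thesis
    unfolding packing_premeasure_def by (simp add: tendsto_Lim)
qed

end

(* Sequences indexed by k \<ge> 1 are extensional functions on {1..}; the index 0 is unused. *)
definition seq_space :: "(nat \<Rightarrow> nat) set" where
  "seq_space = {1..} \<rightarrow>\<^sub>E {1..}"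

definition first_diff :: "(nat \<Rightarrow> nat) \<Rightarrow> (nat \<Rightarrow> nat) \<Rightarrow> nat" where
  "first_diff x y = Inf {n. n \<ge> 1 \<and> x n \<noteq> y n}"

definition seq_dist :: "(nat \<Rightarrow> nat) \<Rightarrow> (nat \<Rightarrow> nat) \<Rightarrow> real" where
  "seq_dist x y = (if x = y then 0 else 1 / 2 ^ first_diff x y)"

lemma Metric_space_seq_space: "Metric_space seq_space seq_dist"
proof
  fix x y z :: "nat \<Rightarrow> nat"
  show "0 \<le> seq_dist x y" by (simp add: seq_dist_def)
  show "seq_dist x y = seq_dist y x"
    by (simp add: seq_dist_def first_diff_def eq_commute)
  show "(seq_dist x y = 0) = (x = y)" by (simp add: seq_dist_def)
  assume xyz: "x \<in> seq_space" "y \<in> seq_space" "z \<in> seq_space"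
  show "seq_dist x z \<le> seq_dist x y + seq_dist y z"
  proof (cases "x = y \<or> y = z \<or> x = z")
    case True
    then show ?thesis by (auto simp: seq_dist_def)
  next
    case False
    have "{n. n \<ge> 1 \<and> x n \<noteq> z n} \<noteq> {}"
    proof -
      have "\<exists>n\<in>{1..}. x n \<noteq> z n"
        using False xyz PiE_ext[of x "{1..}" "\<lambda>_. {1..}" z] by (auto simp: seq_space_def)
      then show ?thesis by auto
    qed
    then have "first_diff x z \<in> {n. n \<ge> 1 \<and> x n \<noteq> z n}"
      unfolding first_diff_def by (rule Inf_nat_def1)
    then have "first_diff x y \<le> first_diff x z \<or> first_diff y z \<le> first_diff x z"
      unfolding first_diff_def
      by (metis (mono_tags, lifting) mem_Collect_eq wellorder_Inf_le1)
    then have "seq_dist x z \<le> seq_dist x y \<or> seq_dist x z \<le> seq_dist y z"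
      using False by (auto simp: seq_dist_def divide_simps)
    moreover have "0 \<le> seq_dist x y" "0 \<le> seq_dist y z" by (simp_all add: seq_dist_def)
    ultimately show ?thesis by linarith
  qed
qed

definition seq_product :: "(nat \<Rightarrow> nat) \<Rightarrow> (nat \<Rightarrow> nat) set" where
  "seq_product n = (\<Pi>\<^sub>E k\<in>{1..}. {1..n k})"

definition compact_product :: "(nat \<Rightarrow> nat) \<Rightarrow> (nat \<Rightarrow> nat) set \<Rightarrow> bool" where
  "compact_product n K \<longleftrightarrow>
     (\<forall>k\<ge>1. n k \<ge> 1) \<and> K = seq_product n \<and>
     compactin (Metric_space.mtopology seq_space seq_dist) K"

definition equilibrium_state :: "(nat \<Rightarrow> nat) \<Rightarrow> (nat \<Rightarrow> nat) measure" where
  "equilibrium_state n = (\<Pi>\<^sub>M k\<in>{1..}. uniform_count_measure {1..n k})"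

end

theory Submission
  imports Defs
begin

text \<open>
  In an ultrametric product \<open>K = \<Prod>\<^sub>k {1..n\<^sub>k}\<close> the ball of radius \<open>r\<close> around any point is the cylinder
  that prescribes the first \<open>k\<close> coordinates, where \<open>2\<^sup>-\<^sup>k\<^sup>-\<^sup>1 < r \<le> 2\<^sup>-\<^sup>k\<close> (for small \<open>r\<close>), and its mass is
  \<open>1 / N\<^sub>k\<close> with \<open>N\<^sub>k = n\<^sub>1 \<cdots> n\<^sub>k\<close>. So \<open>K\<close> splits into finitely many balls of radius \<open>r\<close> of the same mass,
  and neither density depends on the point. There are two independent parts.

  The first part: whenever a density constant \<open>D\<close> is positive and finite, \<open>D\<close> times the
  corresponding measure is \<open>\<mu>\<close> on Borel sets (\<open>hausdorff_measure_eq_emeasure\<close> and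
  \<open>packing_measure_eq_emeasure\<close>). The easy bounds compare contents with \<open>\<mu>\<close> by countable
  (sub)additivity. A cover of \<open>X\<close> by small balls has \<open>\<phi>\<close>-sum at least \<open>\<mu> X / D'\<close> for every
  \<open>D' > D\<close>, and a packing of \<open>A\<close> by small balls has \<open>\<psi>\<close>-sum at most the mass of a neighbourhood of
  \<open>A\<close> divided by \<open>D'\<close>, for \<open>D' < D\<close>, because balls around points of \<open>A\<close> that are disjoint in \<open>A\<close> are
  disjoint in \<open>K\<close>. For the other bounds, a radius that nearly realises the density is good around
  all points at once. The balls of this one radius give a near optimal cover, and a near optimal
  packing, of any set \<open>A\<close>, at cost governed by the mass of the union \<open>nbhd k A\<close> of the
  level-\<open>k\<close> cylinders that meet \<open>A\<close>. To descend from these neighbourhoods to a Borel set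
  \<open>X\<close>, cover \<open>X\<close> by cylinders of total mass close to \<open>\<mu> X\<close> (outer regularity, \<open>ex_cylinder_cover\<close>) and
  use countable subadditivity. The lower bound for the packing measure uses that \<open>X = (\<Union>i. A\<^sub>i)\<close> is
  contained in the union of the closures \<open>\<Inter>\<^sub>k nbhd k A\<^sub>i\<close>.

  The second part: the choice of \<open>n\<close>. Put \<open>a\<^sub>k = 1 / \<phi>(2\<^sup>-\<^sup>k\<^sup>-\<^sup>1)\<close> and \<open>b\<^sub>k = C / \<psi>(2\<^sup>-\<^sup>k)\<close>; both tend to infinity and
  the hypothesis says \<open>a\<^sub>k \<le> b\<^sub>k\<close>. By monotonicity and continuity of \<open>\<phi>\<close> and \<open>\<psi>\<close>, the densities are
  positive and finite as soon as \<open>N\<close> stays between \<open>a\<close> and \<open>b\<close> up to a factor 2 and comes within a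
  factor 2 of each of them infinitely often. The lemma \<open>ex_interpolating_products\<close> builds such an
  \<open>N\<close>: it stays constant until \<open>a\<close> overtakes it, and then jumps alternately to about \<open>a\<^sub>k\<close> and to about \<open>b\<^sub>k\<close>.
\<close>

section \<open>Countable sums as integrals for the counting measure\<close>

lemma nn_integral_count_space_countable:
  fixes f :: "'a \<Rightarrow> ennreal"
  assumes "countable A"
  shows "(\<integral>\<^sup>+x. f x \<partial>count_space A) =
    (\<Sum>i. if i \<in> to_nat_on A ` A then f (from_nat_into A i) else 0)"
proof -
  have "(\<integral>\<^sup>+x. f x \<partial>count_space A) =
      (\<integral>\<^sup>+x. f (from_nat_into A (to_nat_on A x)) \<partial>count_space A)"
    using assms by (intro nn_integral_cong) simp
  also have "\<dots> = (\<integral>\<^sup>+i. f (from_nat_into A i) \<partial>count_space (to_nat_on A ` A))"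
    using assms by (intro nn_integral_bij_count_space[where g = "to_nat_on A"
          and f = "\<lambda>i. f (from_nat_into A i)"] inj_on_imp_bij_betw inj_on_to_nat_on)
  also have "\<dots> = (\<integral>\<^sup>+i. (if i \<in> to_nat_on A ` A then f (from_nat_into A i) else 0) \<partial>count_space UNIV)"
    by (subst nn_integral_count_space_indicator) (auto intro!: nn_integral_cong simp: indicator_def)
  finally show ?thesis
    by (simp add: nn_integral_count_space_nat)
qed

lemma infsum_eq_nn_integral_count_space:
  fixes f :: "'a \<Rightarrow> ennreal"
  assumes "countable A"
  shows "infsum f A = (\<integral>\<^sup>+x. f x \<partial>count_space A)"
proof (rule antisym)
  have "sum f F \<le> (\<integral>\<^sup>+x. f x \<partial>count_space A)" if "finite F" "F \<subseteq> A" for F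
  proof -
    have "sum f F = (\<integral>\<^sup>+x. f x * indicator F x \<partial>count_space A)"
      using that by (subst nn_integral_count_space'[of F]) auto
    also have "\<dots> \<le> (\<integral>\<^sup>+x. f x \<partial>count_space A)"
      by (intro nn_integral_mono) (auto simp: indicator_def)
    finally show ?thesis .
  qed
  then show "infsum f A \<le> (\<integral>\<^sup>+x. f x \<partial>count_space A)"
    by (subst nonneg_infsum_complete) (auto intro!: SUP_least)
  have "(\<Sum>i<m. if i \<in> to_nat_on A ` A then f (from_nat_into A i) else 0) \<le> infsum f A" for m
  proof -
    let ?I = "{..<m} \<inter> to_nat_on A ` A"
    have "(\<Sum>i<m. if i \<in> to_nat_on A ` A then f (from_nat_into A i) else 0)
        = (\<Sum>i\<in>?I. f (from_nat_into A i))"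
      by (rule sum.inter_restrict[symmetric]) simp
    also have "\<dots> = sum f (from_nat_into A ` ?I)"
      using assms by (subst sum.reindex) (auto simp: inj_on_def)
    also have "\<dots> \<le> infsum f A"
      using assms by (subst nonneg_infsum_complete) (auto intro!: SUP_upper)
    finally show ?thesis .
  qed
  then show "(\<integral>\<^sup>+x. f x \<partial>count_space A) \<le> infsum f A"
    by (simp add: nn_integral_count_space_countable assms suminf_le_const)
qed

lemma nn_integral_count_space_UN_le:
  fixes f :: "'a \<Rightarrow> ennreal"
  shows "(\<integral>\<^sup>+x. f x \<partial>count_space (\<Union>i::nat. S i)) \<le> (\<Sum>i. \<integral>\<^sup>+x. f x \<partial>count_space (S i))"
proof -
  \<comment> \<open>The sum of \<open>f\<close> over a set is a measure of that set, so this is subadditivity of measures.\<close>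
  have *: "emeasure (density (count_space UNIV) f) T = (\<integral>\<^sup>+x. f x \<partial>count_space T)" for T
    by (subst emeasure_density)
      (auto simp: nn_integral_restrict_space[symmetric] restrict_count_space)
  show ?thesis
    unfolding *[symmetric] by (rule emeasure_subadditive_countably) simp
qed

lemma emeasure_UN_countable_le:
  assumes "countable I" and "\<And>i. i \<in> I \<Longrightarrow> X i \<in> sets M"
  shows "emeasure M (\<Union>i\<in>I. X i) \<le> (\<integral>\<^sup>+i. emeasure M (X i) \<partial>count_space I)"
proof -
  define Y where "Y j = (if j \<in> to_nat_on I ` I then X (from_nat_into I j) else {})" for j
  have "(\<Union>i\<in>I. X i) = (\<Union>j. Y j)"
    using assms(1) by (auto simp: Y_def split: if_splits)
  moreover have "emeasure M (\<Union>j. Y j) \<le> (\<Sum>j. emeasure M (Y j))"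
    using assms by (intro emeasure_subadditive_countably) (auto simp: Y_def)
  moreover have "(\<Sum>j. emeasure M (Y j)) =
      (\<Sum>i. if i \<in> to_nat_on I ` I then emeasure M (X (from_nat_into I i)) else 0)"
    by (intro arg_cong[where f = suminf]) (auto simp: Y_def)
  ultimately show ?thesis
    using assms(1) by (simp add: nn_integral_count_space_countable)
qed

section \<open>Approximating a factor in the extended nonnegative reals\<close>

lemma ennreal_le_mult_approx_right:
  fixes D h m :: ennreal
  assumes D: "0 < D" "D < \<infinity>" and le: "\<And>D'. D < D' \<Longrightarrow> D' < \<infinity> \<Longrightarrow> m \<le> D' * h"
  shows "m \<le> D * h"
proof (cases "h = \<infinity>")
  case True
  then show ?thesis using D by (simp add: ennreal_mult_top)
next
  case False
  obtain d where d: "D = ennreal d" "d > 0"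
    using D by (cases D) auto
  obtain r where r: "h = ennreal r" "r \<ge> 0"
    using False by (cases h) auto
  have "((\<lambda>e. ennreal ((d + e) * r)) \<longlongrightarrow> ennreal ((d + 0) * r)) (at_right 0)"
    by (intro tendsto_intros)
  moreover have "m \<le> ennreal ((d + e) * r)" if "e > 0" for e
    using le[of "ennreal (d + e)"] d r that by (simp add: ennreal_mult)
  then have "eventually (\<lambda>e. m \<le> ennreal ((d + e) * r)) (at_right 0)"
    by (auto simp: eventually_at_filter)
  ultimately have "m \<le> ennreal ((d + 0) * r)"
    by (intro tendsto_lowerbound) auto
  then show ?thesis
    using d r by (simp add: ennreal_mult)
qed

lemma ennreal_mult_le_approx_left:
  fixes D h m :: ennreal
  assumes "\<And>D'. D' < D \<Longrightarrow> D' * h \<le> m"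
  shows "D * h \<le> m"
proof (cases "D = 0")
  case False
  have "D = (SUP D'\<in>{..<D}. D')"
    by (intro antisym SUP_least) (auto simp: le_Sup_iff dest: dense)
  then have "D * h = (SUP D'\<in>{..<D}. D' * h)"
    using SUP_mult_right_ennreal[of "\<lambda>D'. D'" "{..<D}" h] by simp
  then show ?thesis
    using assms by (auto intro!: SUP_least)
qed auto

section \<open>Hausdorff and packing measures in metric spaces\<close>

context Metric_space
begin

text \<open>Contents are infima and suprema over countable families, for which unconditional sums agree
  with integrals over the counting measure; all later estimates use these integrals.\<close>

lemma hausdorff_content_le:
  assumes "S \<in> eps_covers \<epsilon>"
  shows "hausdorff_content \<phi> \<epsilon> \<le> (\<integral>\<^sup>+p. ennreal (\<phi> (snd p)) \<partial>count_space S)"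
proof -
  have "countable S" using assms by (simp add: eps_covers_def)
  then show ?thesis
    unfolding hausdorff_content_def using assms
    by (subst infsum_eq_nn_integral_count_space[symmetric])
      (auto simp: case_prod_beta' intro: INF_lower)
qed

lemma le_hausdorff_content:
  assumes "\<And>S. S \<in> eps_covers \<epsilon> \<Longrightarrow> c \<le> (\<integral>\<^sup>+p. ennreal (\<phi> (snd p)) \<partial>count_space S)"
  shows "c \<le> hausdorff_content \<phi> \<epsilon>"
  unfolding hausdorff_content_def
proof (rule INF_greatest)
  fix S assume S: "S \<in> eps_covers \<epsilon>"
  then have "countable S" by (simp add: eps_covers_def)
  then show "c \<le> (\<Sum>\<^sub>\<infinity>(x, r)\<in>S. ennreal (\<phi> r))"
    using assms[OF S] by (simp add: infsum_eq_nn_integral_count_space case_prod_beta)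
qed

lemma le_packing_content:
  assumes "S \<in> eps_packs \<epsilon>"
  shows "(\<integral>\<^sup>+p. ennreal (\<phi> (snd p)) \<partial>count_space S) \<le> packing_content \<phi> \<epsilon>"
proof -
  have "countable S" using assms by (simp add: eps_packs_def)
  then show ?thesis
    unfolding packing_content_def using assms
    by (subst infsum_eq_nn_integral_count_space[symmetric])
      (auto simp: case_prod_beta' intro: SUP_upper)
qed

lemma packing_content_mult_le:
  assumes "\<And>S. S \<in> eps_packs \<epsilon> \<Longrightarrow> c * (\<integral>\<^sup>+p. ennreal (\<phi> (snd p)) \<partial>count_space S) \<le> m"
  shows "c * packing_content \<phi> \<epsilon> \<le> m"
  unfolding packing_content_def SUP_mult_left_ennreal
proof (rule SUP_least)
  fix S assume S: "S \<in> eps_packs \<epsilon>"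
  then have "countable S" by (simp add: eps_packs_def)
  then show "c * (\<Sum>\<^sub>\<infinity>(x, r)\<in>S. ennreal (\<phi> r)) \<le> m"
    using assms[OF S] by (simp add: infsum_eq_nn_integral_count_space case_prod_beta)
qed

lemma hausdorff_measure_eq_SUP:
  "hausdorff_measure \<phi> = (SUP \<epsilon>\<in>{0<..}. hausdorff_content \<phi> \<epsilon>)"
proof -
  have "antimono_on {0<..} (hausdorff_content \<phi>)"
    unfolding hausdorff_content_def
    by (intro monotone_onI INF_superset_mono) (fastforce simp: eps_covers_def)+
  from tendsto_unique[OF _ tendsto_hausdorff_measure antimono_on_tendsto_at_right_0[OF this]]
  show ?thesis by simp
qed

lemma packing_premeasure_eq_INF:
  "packing_premeasure \<phi> = (INF \<epsilon>\<in>{0<..}. packing_content \<phi> \<epsilon>)"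
proof -
  have "mono_on {0<..} (packing_content \<phi>)"
    unfolding packing_content_def
    by (intro monotone_onI SUP_subset_mono) (fastforce simp: eps_packs_def)+
  from tendsto_unique[OF _ tendsto_packing_premeasure mono_on_tendsto_at_right_0[OF this]]
  show ?thesis by simp
qed

text \<open>A cover of a part by balls centred in that part is also a family of balls centred in the
  whole space, so no change of radius is needed in the proof.\<close>

lemma hausdorff_content_countably_subadditive:
  assumes M: "M = (\<Union>i::nat. A i)"
  shows "hausdorff_content \<phi> \<epsilon> \<le> (\<Sum>i. Metric_space.hausdorff_content (A i) d \<phi> \<epsilon>)"
proof (rule ennreal_le_epsilon)
  have AM: "A i \<subseteq> M" for i
    using M by auto
  then have sub: "Metric_space (A i) d" for i
    by (rule subspace)
  fix e :: real assume fin: "(\<Sum>i. Metric_space.hausdorff_content (A i) d \<phi> \<epsilon>) < top" and e: "0 < e"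
  let ?h = "\<lambda>i. Metric_space.hausdorff_content (A i) d \<phi> \<epsilon>"
  let ?S = "\<lambda>S. \<integral>\<^sup>+p. ennreal (\<phi> (snd p)) \<partial>count_space S"
  define g where "g i = e * (1/2) ^ Suc i" for i :: nat
  have g: "g i > 0" for i using e by (simp add: g_def)
  have "\<exists>S. S \<in> Metric_space.eps_covers (A i) d \<epsilon> \<and> ?S S \<le> ?h i + ennreal (g i)" for i
  proof (rule ccontr)
    assume "\<not> ?thesis"
    then have "?h i + ennreal (g i) \<le> ?h i"
      by (intro Metric_space.le_hausdorff_content[OF sub]) (meson linear)
    moreover have "?h i < top"
      using fin by (metis ennreal_suminf_lessD)
    ultimately show False
      using g[of i] by (cases "?h i") (auto simp: ennreal_plus[symmetric] simp del: ennreal_plus)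
  qed
  then obtain S where S: "\<And>i. S i \<in> Metric_space.eps_covers (A i) d \<epsilon>"
      "\<And>i. ?S (S i) \<le> ?h i + ennreal (g i)"
    by metis
  have "(\<Union>i. S i) \<in> eps_covers \<epsilon>"
  proof -
    have "x \<in> (\<Union>(x, r)\<in>(\<Union>i. S i). mball x r)" if "x \<in> M" for x
    proof -
      from that M obtain i where "x \<in> A i" by auto
      moreover have "A i \<subseteq> (\<Union>(x, r)\<in>S i. Metric_space.mball (A i) d x r)"
        using S(1)[of i] by (simp add: Metric_space.eps_covers_def[OF sub])
      ultimately obtain y r where "(y, r) \<in> S i" "x \<in> Metric_space.mball (A i) d y r"
        by blast
      moreover from this have "x \<in> mball y r"
        using AM[of i] by (auto simp: Metric_space.in_mball[OF sub])
      ultimately show ?thesis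
        by blast
    qed
    moreover have "countable (S i)" "S i \<subseteq> M \<times> {0<..\<epsilon>}" for i
      using S(1)[of i] AM[of i] by (auto simp: Metric_space.eps_covers_def[OF sub])
    ultimately show ?thesis
      unfolding eps_covers_def by (simp add: UN_subset_iff subset_iff) blast
  qed
  then have "hausdorff_content \<phi> \<epsilon> \<le> ?S (\<Union>i. S i)"
    by (rule hausdorff_content_le)
  also have "\<dots> \<le> (\<Sum>i. ?S (S i))"
    by (rule nn_integral_count_space_UN_le)
  also have "\<dots> \<le> (\<Sum>i. ?h i + ennreal (g i))"
    using S(2) by (intro suminf_le) auto
  also have "\<dots> = (\<Sum>i. ?h i) + (\<Sum>i. ennreal (g i))"
    by (intro suminf_add[symmetric]) auto
  also have "(\<Sum>i. ennreal (g i)) = ennreal e"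
    using sums_mult[OF power_half_series, of e] e
    by (intro suminf_ennreal_eq) (auto simp: g_def)
  finally show "hausdorff_content \<phi> \<epsilon> \<le> (\<Sum>i. ?h i) + ennreal e" .
qed

lemma hausdorff_measure_countably_subadditive:
  assumes M: "M = (\<Union>i::nat. A i)"
  shows "hausdorff_measure \<phi> \<le> (\<Sum>i. Metric_space.hausdorff_measure (A i) d \<phi>)"
proof -
  have sub: "Metric_space (A i) d" for i
    using M by (intro subspace) auto
  have "hausdorff_content \<phi> \<epsilon> \<le> (\<Sum>i. Metric_space.hausdorff_measure (A i) d \<phi>)"
    if "\<epsilon> \<in> {0<..}" for \<epsilon>
  proof -
    have "Metric_space.hausdorff_content (A i) d \<phi> \<epsilon> \<le> Metric_space.hausdorff_measure (A i) d \<phi>" for i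
      unfolding Metric_space.hausdorff_measure_eq_SUP[OF sub] using that by (rule SUP_upper)
    then show ?thesis
      by (intro order_trans[OF hausdorff_content_countably_subadditive[OF M]] suminf_le) auto
  qed
  then show ?thesis
    unfolding hausdorff_measure_eq_SUP by (rule SUP_least)
qed

lemma packing_measure_le_suminf:
  assumes "M = (\<Union>i::nat. A i)"
  shows "packing_measure \<phi> \<le> (\<Sum>i. Metric_space.packing_premeasure (A i) d \<phi>)"
  unfolding packing_measure_def by (rule INF_lower) (use assms in blast)

end

section \<open>Interpolating products\<close>

text \<open>Here \<open>a\<close> and \<open>b\<close> are the lower and upper barriers for the partial products of \<open>n\<close>.\<close>

lemma ex_interpolating_products:
  fixes a b :: "nat \<Rightarrow> real"
  assumes ab: "\<And>k. a k \<le> b k" and a: "filterlim a at_top sequentially" and b: "incseq b"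
  obtains n :: "nat \<Rightarrow> nat" where "\<And>k. 1 \<le> n k"
    "\<forall>\<^sub>F k in sequentially. a k \<le> 2 * (\<Prod>i=1..k. real (n i))"
    "\<exists>\<^sub>F k in sequentially. (\<Prod>i=1..k. real (n i)) \<le> 2 * a k"
    "\<forall>\<^sub>F k in sequentially. (\<Prod>i=1..k. real (n i)) \<le> 2 * b k"
    "\<exists>\<^sub>F k in sequentially. b k \<le> 2 * (\<Prod>i=1..k. real (n i))"
proof -
  \<comment> \<open>The state is the current product together with a flag. The product changes only when \<open>a\<close>
    overtakes it, and the flag, which alternates, decides whether it moves up to \<open>b\<close> (rounding the
    quotient down) or to \<open>a\<close> (rounding up). A quotient exceeds 1 at that moment, so rounding
    changes it by a factor of at most 2.\<close>
  define mult :: "nat \<Rightarrow> nat \<times> bool \<Rightarrow> nat" where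
    "mult k s = (if a (Suc k) \<le> real (fst s) then 1
       else if snd s then nat \<lfloor>b (Suc k) / real (fst s)\<rfloor> else nat \<lceil>a (Suc k) / real (fst s)\<rceil>)" for k s
  define st :: "nat \<Rightarrow> nat \<times> bool" where
    "st = rec_nat (1, False)
       (\<lambda>k s. (fst s * mult k s, if a (Suc k) \<le> real (fst s) then snd s else \<not> snd s))"
  define N where "N k = fst (st k)" for k
  define fl where "fl k = snd (st k)" for k
  define jump where "jump k \<longleftrightarrow> real (N k) < a (Suc k)" for k
  define m where "m k = mult k (st k)" for k
  have N_0: "N 0 = 1" and N_Suc: "N (Suc k) = N k * m k"
    and fl_Suc: "fl (Suc k) = (if jump k then \<not> fl k else fl k)" for k
    by (simp_all add: N_def fl_def jump_def m_def st_def not_le)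
  have m_eq: "m k = (if jump k then if fl k then nat \<lfloor>b (Suc k) / real (N k)\<rfloor>
      else nat \<lceil>a (Suc k) / real (N k)\<rceil> else 1)" for k
    by (simp add: m_def mult_def jump_def N_def fl_def not_le)

  have step: "1 \<le> m k \<and>
      (jump k \<and> fl k \<longrightarrow> real (N (Suc k)) \<le> b (Suc k) \<and> b (Suc k) \<le> 2 * real (N (Suc k))) \<and>
      (jump k \<and> \<not> fl k \<longrightarrow> a (Suc k) \<le> real (N (Suc k)) \<and> real (N (Suc k)) \<le> 2 * a (Suc k))"
    if N: "1 \<le> N k" for k
  proof (cases "jump k")
    case True
    have N': "0 < real (N k)" using N by simp
    show ?thesis
    proof (cases "fl k")
      case fl: True
      define t where "t = b (Suc k) / real (N k)"
      have "a (Suc k) \<le> b (Suc k)" by (rule ab)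
      then have t: "1 < t"
        using True N' by (simp add: jump_def t_def)
      then have fl_t: "1 \<le> \<lfloor>t\<rfloor>" by simp
      have mk: "real (m k) = of_int \<lfloor>t\<rfloor>"
        using fl True t by (simp add: m_eq t_def[symmetric])
      have "of_int \<lfloor>t\<rfloor> \<le> t" "t \<le> 2 * of_int \<lfloor>t\<rfloor>"
        using fl_t by linarith+
      then have "real (N k) * real (m k) \<le> real (N k) * t" "real (N k) * t \<le> real (N k) * (2 * real (m k))"
        unfolding mk using N' by (auto intro!: mult_left_mono)
      moreover have "real (N k) * t = b (Suc k)"
        using N' by (simp add: t_def)
      moreover have "1 \<le> m k"
        using mk fl_t by linarith
      ultimately show ?thesis
        using fl by (simp add: N_Suc)
    next
      case fl: False
      define t where "t = a (Suc k) / real (N k)"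
      have t: "1 < t"
        using True N' by (simp add: jump_def t_def)
      have mk: "real (m k) = of_int \<lceil>t\<rceil>"
        using fl True t by (simp add: m_eq t_def[symmetric])
      have "t \<le> of_int \<lceil>t\<rceil>" "of_int \<lceil>t\<rceil> \<le> 2 * t"
        using t by linarith+
      then have "real (N k) * t \<le> real (N k) * real (m k)" "real (N k) * real (m k) \<le> real (N k) * (2 * t)"
        unfolding mk using N' by (auto intro!: mult_left_mono)
      moreover have "real (N k) * t = a (Suc k)"
        using N' by (simp add: t_def)
      moreover have "1 \<le> m k"
        using mk t by linarith
      ultimately show ?thesis
        using fl by (simp add: N_Suc)
    qed
  next
    case False
    then show ?thesis by (simp add: m_eq)
  qed
  have N_pos: "1 \<le> N k" for k
  proof (induction k)
    case (Suc k)
    then show ?case using step[OF Suc] by (simp add: N_Suc)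
  qed (simp add: N_0)
  note step_k = step[OF N_pos]

  \<comment> \<open>Otherwise every later jump has the other flag, hence sets the flag to \<open>v\<close>; after the first of
    them there is no jump any more, although \<open>a\<close> is unbounded.\<close>
  have jump_flag: "\<exists>k\<ge>k0. jump k \<and> fl k = v" for k0 v
  proof (rule ccontr)
    assume no: "\<not> (\<exists>k\<ge>k0. jump k \<and> fl k = v)"
    have inf: "\<exists>k\<ge>k1. jump k" for k1
    proof (rule ccontr)
      assume "\<not> (\<exists>k\<ge>k1. jump k)"
      then have no_jump: "\<not> jump k" if "k1 \<le> k" for k
        using that by blast
      have const: "N k = N k1" if "k1 \<le> k" for k
        using that
      proof (induction k rule: dec_induct)
        case (step k)
        then show ?case using no_jump[of k] by (simp add: N_Suc m_eq)
      qed simp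
      have "eventually (\<lambda>k. real (N k1) < a k) sequentially"
        using a by (auto simp: filterlim_at_top_dense)
      then obtain k2 where "\<And>k. k2 \<le> k \<Longrightarrow> real (N k1) < a k"
        by (auto simp: eventually_sequentially)
      then have "jump (max k1 k2)"
        using const[of "max k1 k2"] by (simp add: jump_def)
      then show False
        using no_jump[of "max k1 k2"] by simp
    qed
    obtain k1 where k1: "k0 \<le> k1" "jump k1"
      using inf by blast
    have "fl k = v" if "Suc k1 \<le> k" for k
      using that
    proof (induction k rule: dec_induct)
      case base
      show ?case using no k1 by (auto simp: fl_Suc)
    next
      case (step k)
      then show ?case using no k1 by (auto simp: fl_Suc)
    qed
    then show False
      using inf[of "Suc k1"] no k1(1) by (metis Suc_leD order_trans)
  qed

  define n where "n i = (case i of 0 \<Rightarrow> 1 | Suc k \<Rightarrow> m k)" for i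
  have prod: "(\<Prod>i=1..k. real (n i)) = real (N k)" for k
    by (induction k) (simp_all add: N_0 N_Suc n_def)
  show ?thesis
  proof (rule that[of n, unfolded prod])
    show "1 \<le> n k" for k
      using step_k by (cases k) (auto simp: n_def)
    have "a (Suc k) \<le> 2 * real (N (Suc k))" for k
    proof (cases "jump k")
      case True
      then show ?thesis using step_k[of k] ab[of "Suc k"] by (cases "fl k") auto
    next
      case False
      then show ?thesis by (simp add: N_Suc m_eq jump_def)
    qed
    then show "\<forall>\<^sub>F k in sequentially. a k \<le> 2 * real (N k)"
      by (subst eventually_sequentially_Suc[symmetric]) simp
    obtain k0 where k0: "jump k0"
      using jump_flag by blast
    have "real (N k) \<le> 2 * b k" if "Suc k0 \<le> k" for k
      using that
    proof (induction k rule: dec_induct)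
      case base
      then show ?case
        using step_k[of k0] ab[of "Suc k0"] k0 by (cases "fl k0") auto
    next
      case (step k)
      show ?case
      proof (cases "jump k")
        case True
        then show ?thesis
          using step_k[of k] ab[of "Suc k"] by (cases "fl k") auto
      next
        case False
        then show ?thesis
          using step.IH incseqD[OF b, of k "Suc k"] by (simp add: N_Suc m_eq)
      qed
    qed
    then show "\<forall>\<^sub>F k in sequentially. real (N k) \<le> 2 * b k"
      by (auto simp: eventually_sequentially)
    show "\<exists>\<^sub>F k in sequentially. real (N k) \<le> 2 * a k"
      unfolding frequently_sequentially
    proof
      fix k0
      obtain k where "k0 \<le> k" "jump k" "fl k = False"
        using jump_flag by blast
      then show "\<exists>k\<ge>k0. real (N k) \<le> 2 * a k"
        using step_k[of k] by (intro exI[of _ "Suc k"]) auto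
    qed
    show "\<exists>\<^sub>F k in sequentially. b k \<le> 2 * real (N k)"
      unfolding frequently_sequentially
    proof
      fix k0
      obtain k where "k0 \<le> k" "jump k" "fl k = True"
        using jump_flag by blast
      then show "\<exists>k\<ge>k0. b k \<le> 2 * real (N k)"
        using step_k[of k] by (intro exI[of _ "Suc k"]) auto
    qed
  qed
qed

section \<open>Hausdorff functions\<close>

lemma hausdorff_function_pos: "\<phi> \<in> hausdorff_functions \<Longrightarrow> 0 < t \<Longrightarrow> 0 < \<phi> t"
  by (simp add: hausdorff_functions_def)

lemma hausdorff_function_mono:
  "\<phi> \<in> hausdorff_functions \<Longrightarrow> 0 \<le> s \<Longrightarrow> s \<le> t \<Longrightarrow> \<phi> s \<le> \<phi> t"
  by (auto simp: hausdorff_functions_def intro: mono_onD[of "{0..}" \<phi>])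

lemma hausdorff_function_tendsto:
  "\<phi> \<in> hausdorff_functions \<Longrightarrow> 0 \<le> t \<Longrightarrow> (\<phi> \<longlongrightarrow> \<phi> t) (at_right t)"
  unfolding hausdorff_functions_def continuous_on_def
  by (auto intro!: tendsto_within_subset[where S = "{0..}" and T = "{t<..}"])

section \<open>Balls in the space of sequences\<close>

text \<open>The number of coordinates that are constant on the balls of radius \<open>r\<close>. For \<open>r \<le> 1\<close> it is the
  \<open>k\<close> with \<open>2\<^sup>-\<^sup>k\<^sup>-\<^sup>1 < r \<le> 2\<^sup>-\<^sup>k\<close>, and for larger \<open>r\<close> it is \<open>0\<close>.\<close>

definition level :: "real \<Rightarrow> nat" where
  "level r = (LEAST k. 1 / 2 ^ Suc k < r)"

lemma level_less: "0 < r \<Longrightarrow> 1 / 2 ^ Suc (level r) < r"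
proof -
  assume "0 < r"
  then obtain k where "(1 / 2) ^ k < r"
    using real_arch_pow_inv[of r "1/2"] by auto
  moreover have "(1 / 2 :: real) ^ Suc k \<le> (1 / 2) ^ k"
    by (rule power_decreasing) auto
  ultimately have "1 / 2 ^ Suc k < r"
    by (simp add: power_one_over)
  then show ?thesis
    unfolding level_def by (rule LeastI)
qed

lemma level_less_iff: "0 < r \<Longrightarrow> 1 \<le> m \<Longrightarrow> level r < m \<longleftrightarrow> 1 / 2 ^ m < r"
proof
  assume "0 < r" "1 \<le> m" "level r < m"
  then have "(1/2 :: real) ^ m \<le> (1/2) ^ Suc (level r)"
    by (intro power_decreasing) auto
  with level_less[OF \<open>0 < r\<close>] show "1 / 2 ^ m < r"
    by (simp add: power_one_over)
next
  assume "0 < r" "1 \<le> m" "1 / 2 ^ m < r"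
  then have "level r \<le> m - 1"
    unfolding level_def by (intro Least_le) simp
  with \<open>1 \<le> m\<close> show "level r < m" by simp
qed

lemma le_level: "0 < r \<Longrightarrow> r \<le> 1 / 2 ^ k \<Longrightarrow> k \<le> level r"
  using level_less_iff[of r k] by (cases "k = 0") auto

lemma le_of_level: "0 < r \<Longrightarrow> r \<le> 1 \<Longrightarrow> r \<le> 1 / 2 ^ level r"
  using level_less_iff[of r "level r"] by (cases "level r = 0") auto

lemma level_eq:
  assumes "1 / 2 ^ Suc k < r" "r \<le> 1 / 2 ^ k"
  shows "level r = k"
proof -
  have "0 < r"
    using assms(1) by (rule less_trans[rotated]) simp
  then show ?thesis
    using level_less_iff[of r "Suc k"] le_level[of r k] assms by simp
qed

lemma seq_dist_less_iff:
  assumes "x \<in> seq_space" "y \<in> seq_space" "0 < r"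
  shows "seq_dist x y < r \<longleftrightarrow> (\<forall>i\<in>{1..level r}. y i = x i)"
proof (cases "x = y")
  case True
  then show ?thesis using assms by (simp add: seq_dist_def)
next
  case False
  let ?D = "{m. m \<ge> 1 \<and> x m \<noteq> y m}"
  have "\<exists>m\<in>{1..}. x m \<noteq> y m"
    using False assms PiE_ext[of x "{1..}" "\<lambda>_. {1..}" y] by (auto simp: seq_space_def)
  then have mem: "first_diff x y \<in> ?D"
    unfolding first_diff_def by (intro Inf_nat_def1) auto
  have le: "first_diff x y \<le> m" if "m \<in> ?D" for m
    unfolding first_diff_def using that by (rule wellorder_Inf_le1)
  have "seq_dist x y < r \<longleftrightarrow> level r < first_diff x y"
    using False mem assms(3) by (simp add: seq_dist_def level_less_iff)
  also have "\<dots> \<longleftrightarrow> (\<forall>i\<in>{1..level r}. y i = x i)"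
    using mem le by (fastforce simp: not_less[symmetric])
  finally show ?thesis .
qed

section \<open>Cylinders in a product of finite sets\<close>

text \<open>The coordinates of a sequence start at \<open>1\<close>; assuming positivity at the index \<open>0\<close>, too, costs
  nothing, as \<open>n 0\<close> does not enter \<open>K\<close> or \<open>\<mu>\<close>.\<close>

locale cylinders =
  fixes n :: "nat \<Rightarrow> nat"
  assumes n_pos: "1 \<le> n k"
begin

abbreviation K :: "(nat \<Rightarrow> nat) set" where "K \<equiv> seq_product n"

abbreviation \<mu> :: "(nat \<Rightarrow> nat) measure" where "\<mu> \<equiv> equilibrium_state n"

text \<open>The cylinder of level \<open>k\<close> around \<open>x\<close> prescribes the first \<open>k\<close> coordinates; for \<open>x\<close> in \<open>K\<close> it is
  the closed ball of radius \<open>2\<^sup>-\<^sup>k\<^sup>-\<^sup>1\<close>.\<close>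

definition cyl :: "nat \<Rightarrow> (nat \<Rightarrow> nat) \<Rightarrow> (nat \<Rightarrow> nat) set" where
  "cyl k x = {y \<in> K. \<forall>i\<in>{1..k}. y i = x i}"

text \<open>The mass of each cylinder of level \<open>k\<close>.\<close>

definition cyl_mass :: "nat \<Rightarrow> ennreal" where
  "cyl_mass k = ennreal (1 / (\<Prod>i=1..k. real (n i)))"

text \<open>The union of the cylinders of level \<open>k\<close> that meet \<open>A\<close> (for \<open>A \<subseteq> K\<close>).\<close>

definition nbhd :: "nat \<Rightarrow> (nat \<Rightarrow> nat) set \<Rightarrow> (nat \<Rightarrow> nat) set" where
  "nbhd k A = (\<Union>x\<in>A. cyl k x)"

lemma mem_K_iff: "x \<in> K \<longleftrightarrow> x \<in> extensional {1..} \<and> (\<forall>i\<ge>1. x i \<in> {1..n i})"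
  by (auto simp: seq_product_def PiE_iff)

lemma K_subset_seq_space: "K \<subseteq> seq_space"
  unfolding seq_product_def seq_space_def by (rule PiE_mono) auto

lemma Metric_space_subset_K: "A \<subseteq> K \<Longrightarrow> Metric_space A seq_dist"
  using K_subset_seq_space by (intro Metric_space.subspace[OF Metric_space_seq_space]) auto

lemma space_state: "space \<mu> = K"
  by (simp add: equilibrium_state_def space_PiM space_uniform_count_measure seq_product_def)

lemma prob_space_state: "prob_space \<mu>"
  unfolding equilibrium_state_def using n_pos
  by (intro prob_space_PiM prob_space_uniform_count_measure) auto

lemma cyl_eq_prod_emb:
  assumes "x \<in> K"
  shows "cyl k x = prod_emb {1..} (\<lambda>i. uniform_count_measure {1..n i}) {1..k} (\<Pi>\<^sub>E i\<in>{1..k}. {x i})"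
proof -
  have "restrict y {1..k} \<in> (\<Pi>\<^sub>E i\<in>{1..k}. {x i}) \<longleftrightarrow> (\<forall>i\<in>{1..k}. y i = x i)" for y
    by (auto simp: restrict_PiE_iff Pi_iff)
  then show ?thesis
    unfolding cyl_def prod_emb_def seq_product_def space_uniform_count_measure by blast
qed

lemma sets_cyl: "x \<in> K \<Longrightarrow> cyl k x \<in> sets \<mu>"
  unfolding cyl_eq_prod_emb equilibrium_state_def
  by (intro sets_PiM_I) (auto simp: sets_uniform_count_measure mem_K_iff)

lemma emeasure_cyl:
  assumes "x \<in> K"
  shows "emeasure \<mu> (cyl k x) = cyl_mass k"
proof -
  have "emeasure \<mu> (cyl k x) = (\<Prod>i\<in>{1..k}. emeasure (uniform_count_measure {1..n i}) {x i})"
    unfolding cyl_eq_prod_emb[OF assms] equilibrium_state_def using n_pos assms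
    by (intro emeasure_PiM_emb prob_space_uniform_count_measure)
      (auto simp: sets_uniform_count_measure mem_K_iff)
  also have "\<dots> = (\<Prod>i\<in>{1..k}. ennreal (1 / real (n i)))"
    using assms n_pos
    by (intro prod.cong) (auto simp: emeasure_uniform_count_measure mem_K_iff)
  also have "\<dots> = cyl_mass k"
    by (simp add: prod_ennreal cyl_mass_def prod_dividef)
  finally show ?thesis .
qed

lemma cyl_subset_K: "cyl k x \<subseteq> K"
  by (auto simp: cyl_def)

lemma mem_cyl_self: "x \<in> K \<Longrightarrow> x \<in> cyl k x"
  by (auto simp: cyl_def)

lemma cyl_antimono: "k \<le> l \<Longrightarrow> cyl l x \<subseteq> cyl k x"
  by (auto simp: cyl_def)

lemma cyl_eq: "y \<in> cyl k x \<Longrightarrow> l \<le> k \<Longrightarrow> cyl l y = cyl l x"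
  by (auto simp: cyl_def)

lemma nbhd_antimono: "k \<le> l \<Longrightarrow> nbhd l A \<subseteq> nbhd k A"
  unfolding nbhd_def by (intro UN_mono cyl_antimono order_refl)

lemma subset_nbhd: "A \<subseteq> K \<Longrightarrow> A \<subseteq> nbhd k A"
  using mem_cyl_self by (auto simp: nbhd_def)

lemma nbhd_subset_cyl: "A \<subseteq> cyl k x \<Longrightarrow> nbhd k A \<subseteq> cyl k x"
  unfolding nbhd_def by (intro UN_least) (auto dest: subsetD simp: cyl_def)

lemma countable_cyls: "countable {cyl k x |k x. x \<in> K}"
proof -
  let ?C = "\<lambda>k f. {y \<in> K. \<forall>i\<in>{1..k}. y i = f i}"
  have *: "cyl k x \<in> ?C k ` (\<Pi>\<^sub>E i\<in>{1..k}. {1..n i})" if "x \<in> K" for k x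
  proof (rule image_eqI)
    show "cyl k x = ?C k (restrict x {1..k})"
      by (simp add: cyl_def)
    show "restrict x {1..k} \<in> (\<Pi>\<^sub>E i\<in>{1..k}. {1..n i})"
      using that by (simp add: restrict_PiE_iff mem_K_iff)
  qed
  have "{cyl k x |k x. x \<in> K} \<subseteq> (\<Union>k. ?C k ` (\<Pi>\<^sub>E i\<in>{1..k}. {1..n i}))"
    (is "_ \<subseteq> ?U")
  proof (intro subsetI)
    fix B assume "B \<in> {cyl k x |k x. x \<in> K}"
    then obtain k x where B: "B = cyl k x" "x \<in> K"
      by (elim CollectE exE conjE)
    show "B \<in> ?U"
      unfolding B(1) by (rule UN_I[where a = k]) (simp, rule *[OF B(2)])
  qed
  moreover have "countable (\<Union>k. ?C k ` (\<Pi>\<^sub>E i\<in>{1..k}. {1..n i}))"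
    by (intro countable_UN countableI_type countable_image countable_finite[OF finite_PiE]) auto
  ultimately show ?thesis
    by (rule countable_subset)
qed

text \<open>One point of \<open>A\<close> in each cylinder of level \<open>k\<close> that meets \<open>A\<close>.\<close>

lemma ex_transversal:
  assumes "A \<subseteq> K"
  obtains T where "T \<subseteq> A" "countable T" "disjoint_family_on (cyl k) T"
    "nbhd k A = (\<Union>x\<in>T. cyl k x)"
proof -
  let ?T = "inv_into A (cyl k) ` (cyl k ` A)"
  have sub: "?T \<subseteq> A"
    by (auto intro: inv_into_into)
  have "cyl k ` A \<subseteq> {cyl k x |k x. x \<in> K}"
    using assms by auto
  then have "countable ?T"
    using countable_cyls by (blast intro: countable_subset countable_image)
  moreover have "disjoint_family_on (cyl k) ?T"
    unfolding disjoint_family_on_def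
  proof (intro ballI impI, rule ccontr)
    fix s t assume st: "s \<in> ?T" "t \<in> ?T" "s \<noteq> t" "cyl k s \<inter> cyl k t \<noteq> {}"
    then obtain z where "z \<in> cyl k s" "z \<in> cyl k t" by auto
    then have "cyl k s = cyl k t"
      using cyl_eq[of z k s k] cyl_eq[of z k t k] by simp
    moreover have "inj_on (cyl k) ?T"
      by (auto simp: inj_on_def f_inv_into_f)
    ultimately show False
      using st(1-3) by (auto dest: inj_onD)
  qed
  moreover have "nbhd k A = (\<Union>x\<in>?T. cyl k x)"
    by (auto simp: nbhd_def f_inv_into_f)
  ultimately show ?thesis
    by (rule that[OF sub])
qed

lemma sets_nbhd: "A \<subseteq> K \<Longrightarrow> nbhd k A \<in> sets \<mu>"
proof -
  assume A: "A \<subseteq> K"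
  then obtain T where "T \<subseteq> A" "countable T" "nbhd k A = (\<Union>x\<in>T. cyl k x)"
    by (rule ex_transversal)
  then show ?thesis
    using A by (auto intro!: sets.countable_UN' sets_cyl)
qed

lemma emeasure_nbhd:
  assumes "A \<subseteq> K" "T \<subseteq> A" "countable T" "disjoint_family_on (cyl k) T"
    "nbhd k A = (\<Union>x\<in>T. cyl k x)"
  shows "emeasure \<mu> (nbhd k A) = (\<integral>\<^sup>+x. cyl_mass k \<partial>count_space T)"
proof -
  have "emeasure \<mu> (nbhd k A) = (\<integral>\<^sup>+x. emeasure \<mu> (cyl k x) \<partial>count_space T)"
    unfolding assms(5) using assms(1-4) by (intro emeasure_UN_countable sets_cyl) auto
  also have "\<dots> = (\<integral>\<^sup>+x. cyl_mass k \<partial>count_space T)"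
    using assms(1,2) by (intro nn_integral_cong emeasure_cyl) auto
  finally show ?thesis .
qed

lemma mball_eq:
  assumes "A \<subseteq> K" "x \<in> A" "0 < r"
  shows "Metric_space.mball A seq_dist x r = A \<inter> cyl (level r) x"
proof -
  interpret Metric_space A seq_dist
    using assms(1) by (rule Metric_space_subset_K)
  have "seq_dist x y < r \<longleftrightarrow> y \<in> cyl (level r) x" if "y \<in> A" for y
    using that assms K_subset_seq_space
    by (subst seq_dist_less_iff) (auto simp only: cyl_def mem_Collect_eq subset_iff)
  then show ?thesis
    using assms(2) by auto
qed

lemma emeasure_mball:
  assumes "x \<in> K" "0 < r"
  shows "emeasure \<mu> (Metric_space.mball K seq_dist x r) = cyl_mass (level r)"
  unfolding mball_eq[OF order_refl assms]
  using emeasure_cyl[OF assms(1)] cyl_subset_K by (simp only: Int_absorb1)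

section \<open>Compactness\<close>

text \<open>Tychonoff's theorem gives compactness for the product topology, which is at least as fine as
  the metric topology.\<close>

lemma compact_product_K: "compact_product n K"
proof -
  interpret Metric_space seq_space seq_dist
    by (rule Metric_space_seq_space)
  let ?T = "product_topology (\<lambda>k. discrete_topology {1::nat..}) {1::nat..}"
  have "compactin ?T K"
    unfolding seq_product_def by (subst compactin_PiE) (auto simp: compactin_discrete_topology)
  moreover have "continuous_map ?T mtopology id"
    unfolding continuous_map_to_metric
  proof (intro ballI allI impI)
    fix x and \<epsilon> :: real
    assume x: "x \<in> topspace ?T" and \<epsilon>: "0 < \<epsilon>"
    let ?U = "\<Pi>\<^sub>E i\<in>{1..}. if i \<le> level \<epsilon> then {x i} else {1..}"
    have sp: "topspace ?T = seq_space"
      by (simp add: seq_space_def)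
    have "{i \<in> {1..}. (if i \<le> level \<epsilon> then {x i} else {1..}) \<noteq> {1..}} \<subseteq> {..level \<epsilon>}"
      by auto
    then have "openin ?T ?U"
      using x by (subst openin_PiE_gen) (auto intro: finite_subset)
    moreover have "x \<in> ?U"
      using x by auto
    moreover have "?U \<subseteq> seq_space"
      using x unfolding seq_space_def by (intro PiE_mono) auto
    then have "id y \<in> mball (id x) \<epsilon>" if "y \<in> ?U" for y
    proof -
      have "y i = x i" if "i \<in> {1..level \<epsilon>}" for i
        using PiE_mem[OF \<open>y \<in> ?U\<close>, of i] that by auto
      moreover have "y \<in> seq_space"
        using that \<open>?U \<subseteq> seq_space\<close> by blast
      ultimately show ?thesis
        using x \<epsilon> seq_dist_less_iff[of x y \<epsilon>] unfolding sp by simp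
    qed
    ultimately show "\<exists>U. openin ?T U \<and> x \<in> U \<and> (\<forall>y\<in>U. id y \<in> mball (id x) \<epsilon>)"
      by blast
  qed
  ultimately have "compactin mtopology (id ` K)"
    by (rule image_compactin)
  then show ?thesis
    using n_pos by (simp add: compact_product_def)
qed


section \<open>Mass estimates for contents\<close>

text \<open>The balls of one radius around suitable points of \<open>A\<close> are both a cover and a packing of
  \<open>A\<close>.\<close>

lemma ex_radius_transversal:
  assumes "A \<subseteq> K" "0 < r"
  obtains T where "T \<subseteq> A" "countable T"
    "disjoint_family_on (\<lambda>x. Metric_space.mball A seq_dist x r) T"
    "A \<subseteq> (\<Union>x\<in>T. Metric_space.mball A seq_dist x r)"
    "emeasure \<mu> (nbhd (level r) A) = (\<integral>\<^sup>+x. cyl_mass (level r) \<partial>count_space T)"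
proof -
  obtain T where T: "T \<subseteq> A" "countable T" "disjoint_family_on (cyl (level r)) T"
    "nbhd (level r) A = (\<Union>x\<in>T. cyl (level r) x)"
    using ex_transversal[OF assms(1)] by blast
  have ball: "Metric_space.mball A seq_dist x r = A \<inter> cyl (level r) x" if "x \<in> T" for x
    using that T(1) assms by (intro mball_eq) auto
  show ?thesis
  proof (rule that[OF T(1,2)])
    show "disjoint_family_on (\<lambda>x. Metric_space.mball A seq_dist x r) T"
      using T(3) ball unfolding disjoint_family_on_def by blast
    show "A \<subseteq> (\<Union>x\<in>T. Metric_space.mball A seq_dist x r)"
      using subset_nbhd[OF assms(1), of "level r"] ball T(4) by auto
    show "emeasure \<mu> (nbhd (level r) A) = (\<integral>\<^sup>+x. cyl_mass (level r) \<partial>count_space T)"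
      using emeasure_nbhd[OF assms(1) T] .
  qed
qed

lemma nn_integral_fixed_radius:
  "(\<integral>\<^sup>+p. ennreal (\<phi> (snd p)) \<partial>count_space ((\<lambda>x. (x, r)) ` T)) =
    (\<integral>\<^sup>+x. ennreal (\<phi> r) \<partial>count_space T)"
proof -
  have "bij_betw (\<lambda>x. (x, r)) T ((\<lambda>x. (x, r)) ` T)"
    by (auto simp: bij_betw_def inj_on_def)
  from nn_integral_bij_count_space[OF this, of "\<lambda>p. ennreal (\<phi> (snd p))"] show ?thesis
    by simp
qed

lemma mult_hausdorff_content_le:
  assumes "A \<subseteq> K" "0 < r" "r \<le> \<epsilon>" and le: "c * ennreal (\<phi> r) \<le> cyl_mass (level r)"
  shows "c * Metric_space.hausdorff_content A seq_dist \<phi> \<epsilon> \<le> emeasure \<mu> (nbhd (level r) A)"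
proof -
  interpret Metric_space A seq_dist
    using assms(1) by (rule Metric_space_subset_K)
  obtain T where T: "T \<subseteq> A" "countable T" "A \<subseteq> (\<Union>x\<in>T. mball x r)"
    "emeasure \<mu> (nbhd (level r) A) = (\<integral>\<^sup>+x. cyl_mass (level r) \<partial>count_space T)"
    using ex_radius_transversal[OF assms(1,2)] by metis
  have "(\<lambda>x. (x, r)) ` T \<in> eps_covers \<epsilon>"
    unfolding eps_covers_def using T assms(2,3) by auto
  from hausdorff_content_le[OF this, of \<phi>]
  have "c * hausdorff_content \<phi> \<epsilon> \<le> c * (\<integral>\<^sup>+x. ennreal (\<phi> r) \<partial>count_space T)"
    unfolding nn_integral_fixed_radius by (intro mult_left_mono) auto
  also have "\<dots> = (\<integral>\<^sup>+x. c * ennreal (\<phi> r) \<partial>count_space T)"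
    by (rule nn_integral_cmult[symmetric]) simp
  also have "\<dots> \<le> emeasure \<mu> (nbhd (level r) A)"
    unfolding T(4) using le by (intro nn_integral_mono)
  finally show ?thesis .
qed

lemma emeasure_nbhd_le_packing_content:
  assumes "A \<subseteq> K" "0 < r" "r \<le> \<epsilon>" and le: "cyl_mass (level r) \<le> c * ennreal (\<phi> r)"
  shows "emeasure \<mu> (nbhd (level r) A) \<le> c * Metric_space.packing_content A seq_dist \<phi> \<epsilon>"
proof -
  interpret Metric_space A seq_dist
    using assms(1) by (rule Metric_space_subset_K)
  obtain T where T: "T \<subseteq> A" "countable T" "disjoint_family_on (\<lambda>x. mball x r) T"
    "emeasure \<mu> (nbhd (level r) A) = (\<integral>\<^sup>+x. cyl_mass (level r) \<partial>count_space T)"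
    using ex_radius_transversal[OF assms(1,2)] by metis
  have "(\<lambda>x. (x, r)) ` T \<in> eps_packs \<epsilon>"
    unfolding eps_packs_def using T assms(2,3) by (auto simp: disjoint_family_on_def)
  note pack = le_packing_content[OF this, of \<phi>]
  have "emeasure \<mu> (nbhd (level r) A) \<le> (\<integral>\<^sup>+x. c * ennreal (\<phi> r) \<partial>count_space T)"
    unfolding T(4) using le by (intro nn_integral_mono)
  also have "\<dots> = c * (\<integral>\<^sup>+x. ennreal (\<phi> r) \<partial>count_space T)"
    by (rule nn_integral_cmult) simp
  also have "\<dots> \<le> c * packing_content \<phi> \<epsilon>"
    using pack unfolding nn_integral_fixed_radius by (intro mult_left_mono) auto
  finally show ?thesis .
qed

lemma emeasure_le_mult_hausdorff_content:
  assumes X: "X \<subseteq> K" "X \<in> sets \<mu>" and c: "0 < c" "c < \<infinity>"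
    and le: "\<And>r. 0 < r \<Longrightarrow> r \<le> \<epsilon> \<Longrightarrow> cyl_mass (level r) \<le> c * ennreal (\<phi> r)"
  shows "emeasure \<mu> X \<le> c * Metric_space.hausdorff_content X seq_dist \<phi> \<epsilon>"
proof -
  interpret Metric_space X seq_dist
    using X(1) by (rule Metric_space_subset_K)
  have "emeasure \<mu> X \<le> c * (\<integral>\<^sup>+p. ennreal (\<phi> (snd p)) \<partial>count_space S)"
    if S: "S \<in> eps_covers \<epsilon>" for S
  proof -
    have count: "countable S" and sub: "S \<subseteq> X \<times> {0<..\<epsilon>}" and cov: "X \<subseteq> (\<Union>(x, r)\<in>S. mball x r)"
      using S by (auto simp: eps_covers_def)
    have S_D: "fst p \<in> X" "fst p \<in> K" "0 < snd p" "snd p \<le> \<epsilon>" if "p \<in> S" for p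
      using sub that subsetD[OF X(1), of "fst p"] by auto
    have "mball (fst p) (snd p) \<subseteq> cyl (level (snd p)) (fst p)" if "p \<in> S" for p
      using S_D[OF that] by (simp only: mball_eq[OF X(1)] Int_lower2)
    then have "(\<Union>(x, r)\<in>S. mball x r) \<subseteq> (\<Union>p\<in>S. cyl (level (snd p)) (fst p))"
      unfolding case_prod_beta by (intro UN_mono order_refl)
    with cov have "X \<subseteq> (\<Union>p\<in>S. cyl (level (snd p)) (fst p))"
      by (rule order_trans)
    then have "emeasure \<mu> X \<le> emeasure \<mu> (\<Union>p\<in>S. cyl (level (snd p)) (fst p))"
      using S_D(2) count by (intro emeasure_mono sets.countable_UN') (auto intro!: sets_cyl)
    also have "\<dots> \<le> (\<integral>\<^sup>+p. emeasure \<mu> (cyl (level (snd p)) (fst p)) \<partial>count_space S)"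
      using S_D(2) count by (intro emeasure_UN_countable_le sets_cyl) auto
    also have "\<dots> \<le> (\<integral>\<^sup>+p. c * ennreal (\<phi> (snd p)) \<partial>count_space S)"
    proof (rule nn_integral_mono)
      fix p assume "p \<in> space (count_space S)"
      then have "fst p \<in> K" "0 < snd p" "snd p \<le> \<epsilon>"
        using S_D[of p] by auto
      then show "emeasure \<mu> (cyl (level (snd p)) (fst p)) \<le> c * ennreal (\<phi> (snd p))"
        using le by (simp add: emeasure_cyl)
    qed
    also have "\<dots> = c * (\<integral>\<^sup>+p. ennreal (\<phi> (snd p)) \<partial>count_space S)"
      by (rule nn_integral_cmult) simp
    finally show ?thesis .
  qed
  then have "emeasure \<mu> X / c \<le> hausdorff_content \<phi> \<epsilon>"
    using c(1) by (intro le_hausdorff_content divide_le_posI_ennreal)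
  then have "c * (emeasure \<mu> X / c) \<le> c * hausdorff_content \<phi> \<epsilon>"
    by (rule mult_left_mono) simp
  then show ?thesis
    using c by (simp add: ennreal_times_divide mult_divide_eq_ennreal mult.commute[of c])
qed

text \<open>Two balls around points of \<open>A\<close> that are disjoint in \<open>A\<close> are disjoint in \<open>K\<close>: of two
  intersecting cylinders one contains the other, hence also the centre of the other.\<close>

lemma mult_packing_content_le:
  assumes A: "A \<subseteq> K" and \<epsilon>: "\<epsilon> \<le> 1 / 2 ^ k"
    and le: "\<And>r. 0 < r \<Longrightarrow> r \<le> \<epsilon> \<Longrightarrow> c * ennreal (\<phi> r) \<le> cyl_mass (level r)"
  shows "c * Metric_space.packing_content A seq_dist \<phi> \<epsilon> \<le> emeasure \<mu> (nbhd k A)"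
proof -
  interpret Metric_space A seq_dist
    using A by (rule Metric_space_subset_K)
  let ?C = "\<lambda>p. cyl (level (snd p)) (fst p)"
  show ?thesis
  proof (rule packing_content_mult_le)
    fix S assume S: "S \<in> eps_packs \<epsilon>"
    have count: "countable S" and sub: "S \<subseteq> A \<times> {0<..\<epsilon>}"
      and disj: "disjoint_family_on (\<lambda>(x, r). mball x r) S"
      using S by (auto simp: eps_packs_def)
    have S_D: "fst p \<in> A" "0 < snd p" "snd p \<le> \<epsilon>" if "p \<in> S" for p
      using sub that by auto
    have ball: "mball (fst p) (snd p) = A \<inter> ?C p" if "p \<in> S" for p
      using S_D[OF that] A by (intro mball_eq)
    have nested: "?C p \<inter> ?C q = {}"
      if pq: "p \<in> S" "q \<in> S" "p \<noteq> q" "level (snd p) \<le> level (snd q)" for p q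
    proof (rule ccontr)
      assume "?C p \<inter> ?C q \<noteq> {}"
      then obtain z where z: "z \<in> ?C p" "z \<in> ?C q" by auto
      have q: "fst q \<in> A" "fst q \<in> ?C q"
        using S_D[OF pq(2)] A mem_cyl_self by auto
      then have "fst q \<in> ?C p"
        using z pq(4) by (auto simp: cyl_def)
      then have "fst q \<in> mball (fst p) (snd p) \<inter> mball (fst q) (snd q)"
        unfolding ball[OF pq(1)] ball[OF pq(2)] using q by blast
      moreover have "mball (fst p) (snd p) \<inter> mball (fst q) (snd q) = {}"
        using disjoint_family_onD[OF disj pq(1-3)] by (simp add: case_prod_beta)
      ultimately show False
        by simp
    qed
    have disjC: "disjoint_family_on ?C S"
      unfolding disjoint_family_on_def
    proof (intro ballI impI)
      fix p q assume "p \<in> S" "q \<in> S" "p \<noteq> q"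
      then show "?C p \<inter> ?C q = {}"
        using nested[of p q] nested[of q p] by (cases "level (snd p) \<le> level (snd q)") auto
    qed
    have "c * (\<integral>\<^sup>+p. ennreal (\<phi> (snd p)) \<partial>count_space S) =
        (\<integral>\<^sup>+p. c * ennreal (\<phi> (snd p)) \<partial>count_space S)"
      by (rule nn_integral_cmult[symmetric]) simp
    also have "\<dots> \<le> (\<integral>\<^sup>+p. emeasure \<mu> (?C p) \<partial>count_space S)"
    proof (rule nn_integral_mono)
      fix p assume "p \<in> space (count_space S)"
      then have "fst p \<in> K" "0 < snd p" "snd p \<le> \<epsilon>"
        using S_D[of p] A by auto
      then show "c * ennreal (\<phi> (snd p)) \<le> emeasure \<mu> (?C p)"
        using le by (simp add: emeasure_cyl)
    qed
    also have "\<dots> = emeasure \<mu> (\<Union>p\<in>S. ?C p)"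
      using S_D A count disjC by (intro emeasure_UN_countable[symmetric] sets_cyl) auto
    also have "\<dots> \<le> emeasure \<mu> (nbhd k A)"
    proof (intro emeasure_mono sets_nbhd A UN_least)
      fix p assume p: "p \<in> S"
      then have "k \<le> level (snd p)"
        using S_D[OF p] \<epsilon> by (intro le_level) auto
      then show "?C p \<subseteq> nbhd k A"
        unfolding nbhd_def using S_D(1)[OF p] cyl_antimono by blast
    qed
    finally show "c * (\<integral>\<^sup>+p. ennreal (\<phi> (snd p)) \<partial>count_space S) \<le> emeasure \<mu> (nbhd k A)" .
  qed
qed


section \<open>Open sets and outer regularity\<close>

text \<open>The open subsets of \<open>K\<close>, described by means of the cylinders as a basis.\<close>

definition cyl_open :: "(nat \<Rightarrow> nat) set \<Rightarrow> bool" where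
  "cyl_open U \<longleftrightarrow> U \<subseteq> K \<and> (\<forall>x\<in>U. \<exists>k. cyl k x \<subseteq> U)"

lemma openin_iff_cyl_open:
  "openin (Metric_space.mtopology K seq_dist) U \<longleftrightarrow> cyl_open U"
proof -
  interpret Metric_space K seq_dist
    by (rule Metric_space_subset_K) simp
  have "(\<exists>r>0. mball x r \<subseteq> U) \<longleftrightarrow> (\<exists>k. cyl k x \<subseteq> U)" if "x \<in> K" for x
  proof
    assume "\<exists>r>0. mball x r \<subseteq> U"
    then show "\<exists>k. cyl k x \<subseteq> U"
      using that cyl_subset_K by (metis mball_eq[OF order_refl] Int_absorb1)
  next
    assume "\<exists>k. cyl k x \<subseteq> U"
    then obtain k where k: "cyl k x \<subseteq> U" ..
    have "mball x (1 / 2 ^ k) \<subseteq> cyl k x"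
      using that cyl_antimono[OF le_level[of "1 / 2 ^ k" k]]
      by (subst mball_eq) auto
    with k show "\<exists>r>0. mball x r \<subseteq> U"
      by (intro exI[of _ "1 / 2 ^ k"]) auto
  qed
  then show ?thesis
    unfolding openin_mtopology cyl_open_def by blast
qed

lemma cyl_open_cyl: "cyl_open (cyl k x)"
proof -
  have "cyl k y \<subseteq> cyl k x" if "y \<in> cyl k x" for y
    using cyl_eq[OF that order_refl] by simp
  then show ?thesis
    unfolding cyl_open_def using cyl_subset_K by blast
qed

lemma cyl_open_Diff_cyl: "cyl_open (K - cyl k x)"
proof -
  have "cyl k y \<subseteq> K - cyl k x" if "y \<in> K - cyl k x" for y
    using that by (auto simp: cyl_def)
  then show ?thesis
    unfolding cyl_open_def by blast
qed

lemma cyl_open_UN: "(\<And>i. i \<in> I \<Longrightarrow> cyl_open (U i)) \<Longrightarrow> cyl_open (\<Union>i\<in>I. U i)"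
  unfolding cyl_open_def by (meson UN_E UN_least UN_upper order_trans)

lemma cyl_open_Int:
  assumes "cyl_open U" "cyl_open V"
  shows "cyl_open (U \<inter> V)"
  unfolding cyl_open_def
proof (intro conjI ballI)
  show "U \<inter> V \<subseteq> K"
    using assms by (auto simp: cyl_open_def)
  fix x assume "x \<in> U \<inter> V"
  then obtain k l where "cyl k x \<subseteq> U" "cyl l x \<subseteq> V"
    using assms unfolding cyl_open_def by blast
  then have "cyl (max k l) x \<subseteq> U \<inter> V"
    using cyl_antimono[of k "max k l" x] cyl_antimono[of l "max k l" x] by auto
  then show "\<exists>k. cyl k x \<subseteq> U \<inter> V" ..
qed

lemma cyl_open_finite_INT:
  fixes V :: "nat \<Rightarrow> (nat \<Rightarrow> nat) set"
  assumes "\<And>i. cyl_open (V i)"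
  shows "cyl_open (K \<inter> (\<Inter>i<m. V i))"
proof (induction m)
  case 0
  then show ?case using cyl_subset_K by (auto simp: cyl_open_def)
next
  case (Suc m)
  then show ?case
    using cyl_open_Int[OF Suc assms[of m]] by (simp add: lessThan_Suc Int_ac)
qed

text \<open>An open set is the disjoint union of the maximal cylinders that it contains; there are
  countably many of them.\<close>

lemma cyl_open_decomposition:
  assumes U: "cyl_open U"
  obtains C :: "nat \<Rightarrow> (nat \<Rightarrow> nat) set"
  where "\<And>i. C i = {} \<or> (\<exists>k. \<exists>x\<in>K. C i = cyl k x)" "disjoint_family C" "U = (\<Union>i. C i)"
proof -
  define m where "m x = (LEAST k. cyl k x \<subseteq> U)" for x
  define F where "F = (\<lambda>x. cyl (m x) x) ` U"
  have UK: "U \<subseteq> K"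
    using U by (simp add: cyl_open_def)
  have m: "cyl (m x) x \<subseteq> U" if "x \<in> U" for x
  proof -
    have "\<exists>k. cyl k x \<subseteq> U"
      using U that by (simp add: cyl_open_def)
    then obtain k where "cyl k x \<subseteq> U" ..
    then show ?thesis
      unfolding m_def by (rule LeastI)
  qed
  have nested: "cyl (m z) z = cyl (m x) x" if "x \<in> U" "z \<in> cyl (m x) x" for x z
  proof -
    have eq: "cyl l z = cyl l x" if "l \<le> m x" for l
      using cyl_eq[OF \<open>z \<in> cyl (m x) x\<close> that] .
    have "z \<in> U"
      using m[OF that(1)] that(2) by blast
    have "m z \<le> m x"
      unfolding m_def[of z] using m[OF that(1)] eq[of "m x"] by (intro Least_le) simp
    moreover have "m x \<le> m z"
      unfolding m_def[of x] using m[OF \<open>z \<in> U\<close>] eq[OF \<open>m z \<le> m x\<close>] by (intro Least_le) simp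
    ultimately show ?thesis
      using eq[of "m x"] by simp
  qed
  have "F \<subseteq> {cyl k x |k x. x \<in> K}"
    using UK by (auto simp: F_def)
  then have count: "countable F"
    using countable_cyls by (rule countable_subset)
  have UF: "U = \<Union>F"
  proof
    show "U \<subseteq> \<Union>F"
      using mem_cyl_self UK by (auto simp: F_def)
    show "\<Union>F \<subseteq> U"
      using m by (auto simp: F_def)
  qed
  have disj: "A \<inter> B = {}" if AB: "A \<in> F" "B \<in> F" "A \<noteq> B" for A B
  proof (rule ccontr)
    assume "A \<inter> B \<noteq> {}"
    then obtain z where z: "z \<in> A" "z \<in> B" by auto
    from AB obtain x y where xy: "x \<in> U" "A = cyl (m x) x" "y \<in> U" "B = cyl (m y) y"
      unfolding F_def by (elim imageE)
    then show False
      using nested[of x z] nested[of y z] z AB(3) by simp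
  qed
  define C where "C i = (if i \<in> to_nat_on F ` F then from_nat_into F i else {})" for i
  have C_in: "C i = {} \<or> C i \<in> F" for i
    using count by (auto simp: C_def)
  show ?thesis
  proof (rule that[of C])
    show "C i = {} \<or> (\<exists>k. \<exists>x\<in>K. C i = cyl k x)" for i
      using C_in[of i] UK by (auto simp: F_def)
    show "disjoint_family C"
      unfolding disjoint_family_on_def
    proof (intro ballI impI)
      fix i j :: nat assume "i \<noteq> j"
      show "C i \<inter> C j = {}"
      proof (cases "i \<in> to_nat_on F ` F \<and> j \<in> to_nat_on F ` F")
        case True
        then obtain A B where AB: "A \<in> F" "B \<in> F" "i = to_nat_on F A" "j = to_nat_on F B"
          by blast
        then have "C i = A" "C j = B" "A \<noteq> B"
          using count \<open>i \<noteq> j\<close> by (auto simp: C_def)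
        then show ?thesis
          using disj AB by simp
      qed (auto simp: C_def)
    qed
    show "U = (\<Union>i. C i)"
    proof
      show "U \<subseteq> (\<Union>i. C i)"
      proof
        fix x assume "x \<in> U"
        then obtain A where "x \<in> A" "A \<in> F" unfolding UF by blast
        then have "x \<in> C (to_nat_on F A)"
          using count by (simp add: C_def)
        then show "x \<in> (\<Union>i. C i)" by blast
      qed
      show "(\<Union>i. C i) \<subseteq> U"
        unfolding UF using C_in by fastforce
    qed
  qed
qed

lemma cyl_open_sigma_sets:
  assumes "cyl_open U"
  shows "U \<in> sigma_sets K {cyl k x |k x. x \<in> K}"
proof -
  obtain C :: "nat \<Rightarrow> (nat \<Rightarrow> nat) set"
    where C: "\<And>i. C i = {} \<or> (\<exists>k. \<exists>x\<in>K. C i = cyl k x)" "U = (\<Union>i. C i)"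
    using cyl_open_decomposition[OF assms] by metis
  have "C i \<in> sigma_sets K {cyl k x |k x. x \<in> K}" for i
    using C(1)[of i] by (auto intro: sigma_sets.Empty sigma_sets.Basic)
  then show ?thesis
    unfolding C(2) by (rule sigma_sets.Union)
qed

lemma borel_subset_sigma_cyls:
  assumes "X \<in> Metric_space.borel_subsets K seq_dist"
  shows "X \<in> sigma_sets K {cyl k x |k x. x \<in> K}"
proof -
  interpret Metric_space K seq_dist
    by (rule Metric_space_subset_K) simp
  have "sigma_sets K {U. openin mtopology U} \<subseteq> sigma_sets K {cyl k x |k x. x \<in> K}"
    by (rule sigma_sets_mono) (auto simp: openin_iff_cyl_open intro: cyl_open_sigma_sets)
  then show ?thesis
    using assms unfolding borel_subsets_def by blast
qed

lemma sigma_cyls_sets: "sigma_sets K {cyl k x |k x. x \<in> K} \<subseteq> sets \<mu>"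
  using sets.sigma_sets_subset[of "{cyl k x |k x. x \<in> K}" \<mu>] sets_cyl
  unfolding space_state by blast

lemma sets_cyl_open: "cyl_open U \<Longrightarrow> U \<in> sets \<mu>"
  using cyl_open_sigma_sets sigma_cyls_sets by blast

text \<open>The property that is inherited by complements and countable unions is two-sided: a set
  and its complement have open supersets whose overlap has small measure.\<close>

lemma sigma_cyls_approximable:
  assumes "X \<in> sigma_sets K {cyl k x |k x. x \<in> K}" and "0 < e"
  shows "\<exists>U V. cyl_open U \<and> cyl_open V \<and> X \<subseteq> U \<and> K - X \<subseteq> V \<and> emeasure \<mu> (U \<inter> V) \<le> ennreal e"
  using assms
proof (induction arbitrary: e rule: sigma_sets.induct)
  case (Basic X)
  then obtain k x where "X = cyl k x" by blast
  then show ?case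
    by (intro exI[of _ X] exI[of _ "K - X"]) (auto simp: cyl_open_cyl cyl_open_Diff_cyl)
next
  case Empty
  show ?case
    by (intro exI[of _ "{}"] exI[of _ K]) (use cyl_subset_K in \<open>auto simp: cyl_open_def\<close>)
next
  case (Compl X)
  from Compl.IH[OF Compl.prems] obtain U V where
    UV: "cyl_open U" "cyl_open V" "X \<subseteq> U" "K - X \<subseteq> V" "emeasure \<mu> (U \<inter> V) \<le> ennreal e"
    by blast
  then have "K - (K - X) \<subseteq> U" by blast
  with UV show ?case
    by (intro exI[of _ V] exI[of _ U]) (simp add: Int_commute)
next
  case (Union X)
  interpret prob_space \<mu> by (rule prob_space_state)
  \<comment> \<open>Half of \<open>e\<close> is shared among the overlaps \<open>U i \<inter> V i\<close>. The other half allows to keep only finitely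
    many of the sets \<open>V i\<close>, so that their intersection is open.\<close>
  define g where "g i = e / 2 * (1/2) ^ Suc i" for i :: nat
  have g: "g i > 0" for i using Union.prems by (simp add: g_def)
  have "\<forall>i. \<exists>U V. cyl_open U \<and> cyl_open V \<and> X i \<subseteq> U \<and> K - X i \<subseteq> V \<and>
      emeasure \<mu> (U \<inter> V) \<le> ennreal (g i)"
    using Union.IH g by blast
  then obtain U V where UV: "\<And>i. cyl_open (U i)" "\<And>i. cyl_open (V i)" "\<And>i. X i \<subseteq> U i"
    "\<And>i. K - X i \<subseteq> V i" "\<And>i. emeasure \<mu> (U i \<inter> V i) \<le> ennreal (g i)"
    by metis
  define R where "R m = (\<Union>i. U i) - (\<Union>i<m. U i)" for m :: nat
  have sets_U: "U i \<in> sets \<mu>" and sets_V: "V i \<in> sets \<mu>" for i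
    using UV sets_cyl_open by auto
  have "(\<lambda>m. emeasure \<mu> (R m)) \<longlonglongrightarrow> emeasure \<mu> (\<Inter>m. R m)"
  proof (rule Lim_emeasure_decseq)
    show "range R \<subseteq> sets \<mu>"
      using sets_U by (auto simp: R_def)
    show "decseq R"
      by (rule decseq_SucI) (auto simp: R_def lessThan_Suc)
    show "emeasure \<mu> (R i) \<noteq> \<infinity>" for i
      by (rule emeasure_finite[unfolded infinity_ennreal_def[symmetric]])
  qed
  moreover have "(\<Inter>m. R m) = {}"
    by (auto simp: R_def)
  ultimately have "(\<lambda>m. emeasure \<mu> (R m)) \<longlonglongrightarrow> 0"
    by simp
  then have "eventually (\<lambda>m. emeasure \<mu> (R m) < ennreal (e / 2)) sequentially"
    using Union.prems by (intro order_tendstoD) auto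
  then obtain m where m: "emeasure \<mu> (R m) < ennreal (e / 2)"
    by (auto simp: eventually_sequentially)
  let ?U = "\<Union>i. U i" and ?V = "K \<inter> (\<Inter>i<m. V i)"
  have "?U \<inter> ?V \<subseteq> (\<Union>i. U i \<inter> V i) \<union> R m"
    by (auto simp: R_def)
  then have "emeasure \<mu> (?U \<inter> ?V) \<le> emeasure \<mu> ((\<Union>i. U i \<inter> V i) \<union> R m)"
    using sets_U sets_V by (intro emeasure_mono) (auto simp: R_def)
  also have "\<dots> \<le> emeasure \<mu> (\<Union>i. U i \<inter> V i) + emeasure \<mu> (R m)"
    using sets_U sets_V by (intro emeasure_subadditive) (auto simp: R_def)
  also have "emeasure \<mu> (\<Union>i. U i \<inter> V i) \<le> (\<Sum>i. emeasure \<mu> (U i \<inter> V i))"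
    using sets_U sets_V by (intro emeasure_subadditive_countably) auto
  also have "\<dots> \<le> (\<Sum>i. ennreal (g i))"
    using UV(5) by (intro suminf_le) auto
  also have "\<dots> = ennreal (e / 2)"
    using sums_mult[OF power_half_series, of "e / 2"] g
    by (intro suminf_ennreal_eq) (auto simp: g_def intro: less_imp_le)
  also have "ennreal (e / 2) + emeasure \<mu> (R m) \<le> ennreal (e / 2) + ennreal (e / 2)"
    using m by (intro add_left_mono less_imp_le)
  also have "\<dots> = ennreal e"
    using Union.prems by (simp add: ennreal_plus[symmetric] del: ennreal_plus)
  finally have "emeasure \<mu> (?U \<inter> ?V) \<le> ennreal e"
    by (simp add: add_right_mono)
  moreover have "cyl_open ?U" "cyl_open ?V"
    using UV by (auto intro: cyl_open_UN cyl_open_finite_INT)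
  moreover have "(\<Union>i. X i) \<subseteq> ?U" "K - (\<Union>i. X i) \<subseteq> ?V"
    using UV(3,4) by blast+
  ultimately show ?case
    by blast
qed

lemma ex_cylinder_cover:
  assumes X: "X \<in> sigma_sets K {cyl k x |k x. x \<in> K}" and e: "0 < e"
  obtains C :: "nat \<Rightarrow> (nat \<Rightarrow> nat) set"
  where "\<And>i. C i = {} \<or> (\<exists>k. \<exists>x\<in>K. C i = cyl k x)" "X \<subseteq> (\<Union>i. C i)"
    "(\<Sum>i. emeasure \<mu> (C i)) \<le> emeasure \<mu> X + ennreal e"
proof -
  obtain U V where UV: "cyl_open U" "cyl_open V" "X \<subseteq> U" "K - X \<subseteq> V"
      "emeasure \<mu> (U \<inter> V) \<le> ennreal e"
    using sigma_cyls_approximable[OF assms] by blast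
  obtain C :: "nat \<Rightarrow> (nat \<Rightarrow> nat) set" where
    C: "\<And>i. C i = {} \<or> (\<exists>k. \<exists>x\<in>K. C i = cyl k x)" "disjoint_family C" "U = (\<Union>i. C i)"
    using cyl_open_decomposition[OF UV(1)] by blast
  have sets_C: "C i \<in> sets \<mu>" for i
    using C(1)[of i] sets_cyl by auto
  have "(\<Sum>i. emeasure \<mu> (C i)) = emeasure \<mu> U"
    unfolding C(3) using sets_C C(2) by (intro suminf_emeasure) auto
  also have "\<dots> \<le> emeasure \<mu> (X \<union> (U \<inter> V))"
    using UV X sigma_cyls_sets sets_cyl_open
    by (intro emeasure_mono) (auto simp: cyl_open_def)
  also have "\<dots> \<le> emeasure \<mu> X + emeasure \<mu> (U \<inter> V)"
    using UV X sigma_cyls_sets sets_cyl_open by (intro emeasure_subadditive) auto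
  also have "\<dots> \<le> emeasure \<mu> X + ennreal e"
    using UV(5) by (rule add_left_mono)
  finally show ?thesis
    using that[of C] C UV(3) by simp
qed

section \<open>The densities\<close>

text \<open>The common values of the upper and of the lower density at the points of \<open>K\<close>.\<close>

definition upper_dens :: "(real \<Rightarrow> real) \<Rightarrow> ennreal" where
  "upper_dens \<phi> = Limsup (at_right 0) (\<lambda>r. cyl_mass (level r) / ennreal (\<phi> r))"

definition lower_dens :: "(real \<Rightarrow> real) \<Rightarrow> ennreal" where
  "lower_dens \<phi> = Liminf (at_right 0) (\<lambda>r. cyl_mass (level r) / ennreal (\<phi> r))"

lemma eventually_emeasure_mball:
  assumes "x \<in> K"
  shows "\<forall>\<^sub>F r in at_right 0. emeasure \<mu> (Metric_space.mball K seq_dist x r) / ennreal (\<phi> r) =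
    cyl_mass (level r) / ennreal (\<phi> r)"
  using emeasure_mball[OF assms] by (auto simp: eventually_at_filter)

lemma upper_density_eq: "x \<in> K \<Longrightarrow> Metric_space.upper_density K seq_dist \<mu> \<phi> x = upper_dens \<phi>"
  unfolding Metric_space.upper_density_def[OF Metric_space_subset_K[OF order_refl]] upper_dens_def
  by (intro Limsup_eq eventually_emeasure_mball)

lemma lower_density_eq: "x \<in> K \<Longrightarrow> Metric_space.lower_density K seq_dist \<mu> \<phi> x = lower_dens \<phi>"
  unfolding Metric_space.lower_density_def[OF Metric_space_subset_K[OF order_refl]] lower_dens_def
  by (intro Liminf_eq eventually_emeasure_mball)

lemma cyl_mass_div:
  assumes "\<phi> \<in> hausdorff_functions" "0 < r"
  shows "cyl_mass k / ennreal (\<phi> r) = ennreal (1 / ((\<Prod>i=1..k. real (n i)) * \<phi> r))"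
  unfolding cyl_mass_def using hausdorff_function_pos[OF assms]
  by (subst divide_ennreal) (auto intro!: prod_nonneg)

lemma cyl_count_pos: "0 < (\<Prod>i=1..k. real (n i))"
  using n_pos by (intro prod_pos) (simp add: Suc_le_eq)

text \<open>Bounds for the densities in terms of \<open>N\<^sub>k = n\<^sub>1 \<cdots> n\<^sub>k\<close>. On the radii of level \<open>k\<close>, which run through
  \<open>]2\<^sup>-\<^sup>k\<^sup>-\<^sup>1, 2\<^sup>-\<^sup>k]\<close> for \<open>k \<ge> 1\<close>, the quotient of mass and gauge is largest near the left endpoint and smallest
  at the right one. The left endpoint is not attained: only there continuity of the gauge is
  needed, and a factor 2 is given away for it.\<close>

lemma upper_dens_le:
  assumes \<phi>: "\<phi> \<in> hausdorff_functions" and c: "0 < c"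
    and ev: "\<forall>\<^sub>F k in sequentially. 1 / \<phi> (1 / 2 ^ Suc k) \<le> c * (\<Prod>i=1..k. real (n i))"
  shows "upper_dens \<phi> \<le> ennreal c"
proof -
  from ev obtain k0 where
    k0: "\<And>k. k0 \<le> k \<Longrightarrow> 1 / \<phi> (1 / 2 ^ Suc k) \<le> c * (\<Prod>i=1..k. real (n i))"
    by (auto simp: eventually_sequentially)
  have "cyl_mass (level r) / ennreal (\<phi> r) \<le> ennreal c" if r: "0 < r" "r < 1 / 2 ^ k0" for r
  proof -
    let ?N = "\<Prod>i=1..level r. real (n i)"
    have pos: "0 < \<phi> (1 / 2 ^ Suc (level r))" "0 < ?N"
      using hausdorff_function_pos[OF \<phi>] cyl_count_pos by auto
    have "k0 \<le> level r"
      using r by (intro le_level) auto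
    then have "1 \<le> c * ?N * \<phi> (1 / 2 ^ Suc (level r))"
      using k0[of "level r"] pos by (simp add: pos_divide_le_eq)
    also have "\<dots> \<le> c * ?N * \<phi> r"
      using level_less[OF r(1)] c pos
      by (intro mult_left_mono hausdorff_function_mono[OF \<phi>]) auto
    finally have "1 / (?N * \<phi> r) \<le> c"
      using pos hausdorff_function_pos[OF \<phi> r(1)] by (simp add: pos_divide_le_eq mult.assoc)
    then show ?thesis
      unfolding cyl_mass_div[OF \<phi> r(1)] by (rule ennreal_leI)
  qed
  then show ?thesis
    unfolding upper_dens_def
    by (intro Limsup_bounded) (auto simp: eventually_at_right_field intro!: exI[of _ "1 / 2 ^ k0"])
qed

lemma lower_dens_ge:
  assumes \<phi>: "\<phi> \<in> hausdorff_functions" and c: "0 < c"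
    and ev: "\<forall>\<^sub>F k in sequentially. c * (\<Prod>i=1..k. real (n i)) \<le> 1 / \<phi> (1 / 2 ^ k)"
  shows "ennreal c \<le> lower_dens \<phi>"
proof -
  from ev obtain k0 where
    k0: "\<And>k. k0 \<le> k \<Longrightarrow> c * (\<Prod>i=1..k. real (n i)) \<le> 1 / \<phi> (1 / 2 ^ k)"
    by (auto simp: eventually_sequentially)
  have "ennreal c \<le> cyl_mass (level r) / ennreal (\<phi> r)" if r: "0 < r" "r < 1 / 2 ^ k0" for r
  proof -
    let ?N = "\<Prod>i=1..level r. real (n i)"
    have pos: "0 < \<phi> (1 / 2 ^ level r)" "0 < ?N" "0 < \<phi> r"
      using hausdorff_function_pos[OF \<phi>] cyl_count_pos r(1) by auto
    have le: "r \<le> 1 / 2 ^ level r"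
    proof (rule le_of_level[OF r(1)])
      have "1 / 2 ^ k0 \<le> (1 :: real)"
        by simp
      with r(2) show "r \<le> 1" by linarith
    qed
    have "k0 \<le> level r"
      using r by (intro le_level) auto
    have "c * ?N * \<phi> r \<le> c * ?N * \<phi> (1 / 2 ^ level r)"
      using le c pos r(1) by (intro mult_left_mono hausdorff_function_mono[OF \<phi>]) auto
    also have "\<dots> \<le> 1"
      using k0[OF \<open>k0 \<le> level r\<close>] pos by (simp add: pos_le_divide_eq)
    finally have "c \<le> 1 / (?N * \<phi> r)"
      using pos by (simp add: pos_le_divide_eq mult.assoc)
    then show ?thesis
      unfolding cyl_mass_div[OF \<phi> r(1)] by (rule ennreal_leI)
  qed
  then show ?thesis
    unfolding lower_dens_def
    by (intro Liminf_bounded) (auto simp: eventually_at_right_field intro!: exI[of _ "1 / 2 ^ k0"])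
qed

lemma upper_dens_ge:
  assumes \<phi>: "\<phi> \<in> hausdorff_functions" and c: "0 < c"
    and fr: "\<exists>\<^sub>F k in sequentially. c * (\<Prod>i=1..k. real (n i)) \<le> 1 / \<phi> (1 / 2 ^ Suc k)"
  shows "ennreal (c / 2) \<le> upper_dens \<phi>"
proof (rule ccontr)
  assume "\<not> ?thesis"
  then have "\<forall>\<^sub>F r in at_right 0. cyl_mass (level r) / ennreal (\<phi> r) < ennreal (c / 2)"
    unfolding upper_dens_def by (intro Limsup_lessD) simp
  then obtain e where e: "0 < e" and
    less: "\<And>r. 0 < r \<Longrightarrow> r < e \<Longrightarrow> cyl_mass (level r) / ennreal (\<phi> r) < ennreal (c / 2)"
    by (auto simp: eventually_at_right_field)
  obtain k0 where k0: "1 / 2 ^ k0 < e"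
    using real_arch_pow_inv[OF e, of "1/2"] by (auto simp: power_one_over)
  obtain k where k: "k0 \<le> k" "c * (\<Prod>i=1..k. real (n i)) \<le> 1 / \<phi> (1 / 2 ^ Suc k)"
    using fr by (auto simp: frequently_sequentially)
  let ?N = "\<Prod>i=1..k. real (n i)" and ?s = "1 / 2 ^ Suc k :: real"
  have pos: "0 < \<phi> ?s" "0 < ?N"
    using hausdorff_function_pos[OF \<phi>] cyl_count_pos by auto
  have "\<forall>\<^sub>F r in at_right ?s. \<phi> r < 2 * \<phi> ?s"
    using pos by (intro order_tendstoD[OF hausdorff_function_tendsto[OF \<phi>]]) auto
  moreover have "\<forall>\<^sub>F r in at_right ?s. r < 1 / 2 ^ k"
    by (auto simp: eventually_at_right_field divide_simps intro!: exI[of _ "1 / 2 ^ k"])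
  ultimately have "\<forall>\<^sub>F r in at_right ?s. \<phi> r < 2 * \<phi> ?s \<and> r < 1 / 2 ^ k \<and> ?s < r"
    by (intro eventually_conj eventually_at_right_less)
  then obtain r where r: "\<phi> r < 2 * \<phi> ?s" "r < 1 / 2 ^ k" "?s < r"
    using eventually_happens[of _ "at_right ?s"] by auto
  have "0 < r"
    using r(3) by (rule less_trans[rotated]) simp
  have "1 / 2 ^ k \<le> (1 / 2 ^ k0 :: real)"
    using k(1) by (simp add: frac_le)
  then have "cyl_mass k / ennreal (\<phi> r) < ennreal (c / 2)"
    using less[OF \<open>0 < r\<close>] level_eq[OF r(3) less_imp_le[OF r(2)]] r(2) k0 by simp
  then have "1 / (?N * \<phi> r) < c / 2"
    unfolding cyl_mass_div[OF \<phi> \<open>0 < r\<close>]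
    using pos(2) hausdorff_function_pos[OF \<phi> \<open>0 < r\<close>]
    by (subst (asm) ennreal_less_iff) (auto intro: less_imp_le)
  then have "1 < c / 2 * (?N * \<phi> r)"
    using pos hausdorff_function_pos[OF \<phi> \<open>0 < r\<close>] by (simp add: pos_divide_less_eq)
  also have "\<dots> \<le> c / 2 * (?N * (2 * \<phi> ?s))"
    using r(1) c pos by (intro mult_left_mono) auto
  also have "\<dots> = c * ?N * \<phi> ?s"
    by simp
  also have "\<dots> \<le> 1"
    using k(2) pos(1) by (simp add: pos_le_divide_eq)
  finally show False by simp
qed

lemma lower_dens_le:
  assumes \<phi>: "\<phi> \<in> hausdorff_functions" and c: "0 < c"
    and fr: "\<exists>\<^sub>F k in sequentially. 1 / \<phi> (1 / 2 ^ k) \<le> c * (\<Prod>i=1..k. real (n i))"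
  shows "lower_dens \<phi> \<le> ennreal c"
proof (rule ccontr)
  assume "\<not> ?thesis"
  then have "\<forall>\<^sub>F r in at_right 0. ennreal c < cyl_mass (level r) / ennreal (\<phi> r)"
    unfolding lower_dens_def by (intro less_LiminfD) simp
  then obtain e where e: "0 < e" and
    less: "\<And>r. 0 < r \<Longrightarrow> r < e \<Longrightarrow> ennreal c < cyl_mass (level r) / ennreal (\<phi> r)"
    by (auto simp: eventually_at_right_field)
  obtain k0 where k0: "1 / 2 ^ k0 < e"
    using real_arch_pow_inv[OF e, of "1/2"] by (auto simp: power_one_over)
  obtain k where k: "k0 \<le> k" "1 / \<phi> (1 / 2 ^ k) \<le> c * (\<Prod>i=1..k. real (n i))"
    using fr by (auto simp: frequently_sequentially)
  let ?N = "\<Prod>i=1..k. real (n i)" and ?r = "1 / 2 ^ k :: real"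
  have pos: "0 < \<phi> ?r" "0 < ?N"
    using hausdorff_function_pos[OF \<phi>] cyl_count_pos by auto
  have "level ?r = k"
    by (rule level_eq) (auto simp: divide_simps)
  moreover have "?r \<le> 1 / 2 ^ k0"
    using k(1) by (simp add: frac_le)
  ultimately have "ennreal c < cyl_mass k / ennreal (\<phi> ?r)"
    using less[of ?r] k0 by simp
  then have "c < 1 / (?N * \<phi> ?r)"
    using c by (subst (asm) cyl_mass_div[OF \<phi>]) (auto simp: ennreal_less_iff)
  then have "c * ?N * \<phi> ?r < 1"
    using pos by (simp add: pos_less_divide_eq mult.assoc)
  moreover have "1 \<le> c * ?N * \<phi> ?r"
    using k(2) pos(1) by (simp add: pos_divide_le_eq)
  ultimately show False by simp
qed

section \<open>Hausdorff and packing measures of subsets of the product\<close>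

lemma div_less_imp_le_mult:
  assumes "\<phi> \<in> hausdorff_functions" "0 < r"
  shows "m / ennreal (\<phi> r) < c \<Longrightarrow> m \<le> c * ennreal (\<phi> r)"
    and "c < m / ennreal (\<phi> r) \<Longrightarrow> c * ennreal (\<phi> r) \<le> m"
proof -
  have p: "0 < ennreal (\<phi> r)" "ennreal (\<phi> r) < \<infinity>"
    using hausdorff_function_pos[OF assms] by auto
  show "m / ennreal (\<phi> r) < c \<Longrightarrow> m \<le> c * ennreal (\<phi> r)"
    using p by (subst (asm) divide_less_ennreal) auto
  assume "c < m / ennreal (\<phi> r)"
  then have "c * ennreal (\<phi> r) \<le> m / ennreal (\<phi> r) * ennreal (\<phi> r)"
    by (intro mult_right_mono) auto
  also have "\<dots> = m"
    using p by (simp add: ennreal_divide_times)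
  finally show "c * ennreal (\<phi> r) \<le> m" .
qed

lemma ex_small_radius:
  assumes "\<exists>\<^sub>F r in at_right (0::real). P r" "0 < e"
  obtains r where "0 < r" "r \<le> e" "P r"
proof -
  have "\<exists>\<^sub>F r in at_right 0. P r \<and> 0 < r \<and> r < e"
  proof (rule frequently_rev_mp[OF assms(1)])
    show "\<forall>\<^sub>F r in at_right 0. P r \<longrightarrow> P r \<and> 0 < r \<and> r < e"
      using assms(2) by (auto simp: eventually_at_right_field intro!: exI[of _ e])
  qed
  then show ?thesis
    using that by (auto dest!: frequently_ex)
qed

lemma emeasure_le_hausdorff_measure:
  assumes \<phi>: "\<phi> \<in> hausdorff_functions" and D: "0 < upper_dens \<phi>" "upper_dens \<phi> < \<infinity>"
    and X: "X \<subseteq> K" "X \<in> sets \<mu>"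
  shows "emeasure \<mu> X \<le> upper_dens \<phi> * Metric_space.hausdorff_measure X seq_dist \<phi>"
proof (rule ennreal_le_mult_approx_right[OF D])
  interpret Metric_space X seq_dist
    using X(1) by (rule Metric_space_subset_K)
  fix D' assume D': "upper_dens \<phi> < D'" "D' < \<infinity>"
  then have "\<forall>\<^sub>F r in at_right 0. cyl_mass (level r) / ennreal (\<phi> r) < D'"
    unfolding upper_dens_def by (intro Limsup_lessD)
  then obtain e where e: "0 < e" and
    less: "\<And>r. 0 < r \<Longrightarrow> r < e \<Longrightarrow> cyl_mass (level r) / ennreal (\<phi> r) < D'"
    by (auto simp: eventually_at_right_field)
  have "emeasure \<mu> X \<le> D' * hausdorff_content \<phi> (e / 2)"
  proof (rule emeasure_le_mult_hausdorff_content[OF X])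
    show "0 < D'" using D' D(1) by simp
    fix r :: real assume r: "0 < r" "r \<le> e / 2"
    then have "r < e" using e by simp
    then show "cyl_mass (level r) \<le> D' * ennreal (\<phi> r)"
      using less[OF r(1)] by (intro div_less_imp_le_mult(1)[OF \<phi> r(1)])
  qed (rule D'(2))
  also have "\<dots> \<le> D' * hausdorff_measure \<phi>"
    unfolding hausdorff_measure_eq_SUP using e by (intro mult_left_mono SUP_upper) auto
  finally show "emeasure \<mu> X \<le> D' * hausdorff_measure \<phi>" .
qed

lemma hausdorff_measure_le_nbhd:
  assumes \<phi>: "\<phi> \<in> hausdorff_functions" and A: "A \<subseteq> K"
  shows "upper_dens \<phi> * Metric_space.hausdorff_measure A seq_dist \<phi> \<le> emeasure \<mu> (nbhd k A)"
proof (rule ennreal_mult_le_approx_left)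
  interpret Metric_space A seq_dist
    using A by (rule Metric_space_subset_K)
  fix D' assume D': "D' < upper_dens \<phi>"
  have freq: "\<exists>\<^sub>F r in at_right 0. D' < cyl_mass (level r) / ennreal (\<phi> r)"
  proof (rule ccontr)
    assume "\<not> ?thesis"
    then have "upper_dens \<phi> \<le> D'"
      unfolding upper_dens_def by (intro Limsup_bounded) (simp add: not_frequently not_less)
    with D' show False by simp
  qed
  have "D' * hausdorff_content \<phi> \<epsilon> \<le> emeasure \<mu> (nbhd k A)" if "0 < \<epsilon>" for \<epsilon>
  proof -
    obtain r where r: "0 < r" "r \<le> min \<epsilon> (1 / 2 ^ k)" "D' < cyl_mass (level r) / ennreal (\<phi> r)"
      using ex_small_radius[OF freq, of "min \<epsilon> (1 / 2 ^ k)"] \<open>0 < \<epsilon>\<close> by auto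
    have "D' * hausdorff_content \<phi> \<epsilon> \<le> emeasure \<mu> (nbhd (level r) A)"
      using r by (intro mult_hausdorff_content_le A div_less_imp_le_mult(2)[OF \<phi>]) auto
    also have "\<dots> \<le> emeasure \<mu> (nbhd k A)"
      using r by (intro emeasure_mono nbhd_antimono le_level sets_nbhd A) auto
    finally show ?thesis .
  qed
  then show "D' * hausdorff_measure \<phi> \<le> emeasure \<mu> (nbhd k A)"
    unfolding hausdorff_measure_eq_SUP SUP_mult_left_ennreal by (intro SUP_least) auto
qed

lemma packing_premeasure_le_nbhd:
  assumes \<psi>: "\<psi> \<in> hausdorff_functions" and A: "A \<subseteq> K"
  shows "lower_dens \<psi> * Metric_space.packing_premeasure A seq_dist \<psi> \<le> emeasure \<mu> (nbhd k A)"
proof (rule ennreal_mult_le_approx_left)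
  interpret Metric_space A seq_dist
    using A by (rule Metric_space_subset_K)
  fix D' assume D': "D' < lower_dens \<psi>"
  then have "\<forall>\<^sub>F r in at_right 0. D' < cyl_mass (level r) / ennreal (\<psi> r)"
    unfolding lower_dens_def by (intro less_LiminfD)
  then obtain e where e: "0 < e" and
    less: "\<And>r. 0 < r \<Longrightarrow> r < e \<Longrightarrow> D' < cyl_mass (level r) / ennreal (\<psi> r)"
    by (auto simp: eventually_at_right_field)
  define \<epsilon> where "\<epsilon> = min (e / 2) (1 / 2 ^ k)"
  have \<epsilon>: "0 < \<epsilon>" "\<epsilon> < e" "\<epsilon> \<le> 1 / 2 ^ k"
    using e by (auto simp: \<epsilon>_def)
  have "D' * packing_premeasure \<psi> \<le> D' * packing_content \<psi> \<epsilon>"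
    unfolding packing_premeasure_eq_INF using \<epsilon>(1) by (intro mult_left_mono INF_lower) auto
  also have "\<dots> \<le> emeasure \<mu> (nbhd k A)"
    using \<epsilon> less by (intro mult_packing_content_le A div_less_imp_le_mult(2)[OF \<psi>]) auto
  finally show "D' * packing_premeasure \<psi> \<le> emeasure \<mu> (nbhd k A)" .
qed

text \<open>The intersection on the left is the closure of \<open>A\<close> in \<open>K\<close>.\<close>

lemma emeasure_le_packing_premeasure:
  assumes \<psi>: "\<psi> \<in> hausdorff_functions" and D: "0 < lower_dens \<psi>" "lower_dens \<psi> < \<infinity>"
    and A: "A \<subseteq> K"
  shows "emeasure \<mu> (\<Inter>k. nbhd k A) \<le> lower_dens \<psi> * Metric_space.packing_premeasure A seq_dist \<psi>"
proof (rule ennreal_le_mult_approx_right[OF D])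
  interpret Metric_space A seq_dist
    using A by (rule Metric_space_subset_K)
  fix D' assume D': "lower_dens \<psi> < D'" "D' < \<infinity>"
  have "0 < D'" using D' D(1) by simp
  have freq: "\<exists>\<^sub>F r in at_right 0. cyl_mass (level r) / ennreal (\<psi> r) < D'"
  proof (rule ccontr)
    assume "\<not> ?thesis"
    then have "D' \<le> lower_dens \<psi>"
      unfolding lower_dens_def by (intro Liminf_bounded) (simp add: not_frequently not_less)
    with D' show False by simp
  qed
  have "emeasure \<mu> (\<Inter>k. nbhd k A) / D' \<le> packing_content \<psi> \<epsilon>" if "0 < \<epsilon>" for \<epsilon>
  proof -
    obtain r where r: "0 < r" "r \<le> \<epsilon>" "cyl_mass (level r) / ennreal (\<psi> r) < D'"
      using ex_small_radius[OF freq \<open>0 < \<epsilon>\<close>] by auto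
    have "emeasure \<mu> (\<Inter>k. nbhd k A) \<le> emeasure \<mu> (nbhd (level r) A)"
      by (intro emeasure_mono sets_nbhd A INT_lower UNIV_I)
    also have "\<dots> \<le> D' * packing_content \<psi> \<epsilon>"
      using r by (intro emeasure_nbhd_le_packing_content A div_less_imp_le_mult(1)[OF \<psi>]) auto
    finally show ?thesis
      using \<open>0 < D'\<close> by (rule divide_le_posI_ennreal[rotated])
  qed
  then have "emeasure \<mu> (\<Inter>k. nbhd k A) / D' \<le> packing_premeasure \<psi>"
    unfolding packing_premeasure_eq_INF by (intro INF_greatest) auto
  then have "D' * (emeasure \<mu> (\<Inter>k. nbhd k A) / D') \<le> D' * packing_premeasure \<psi>"
    by (rule mult_left_mono) simp
  then show "emeasure \<mu> (\<Inter>k. nbhd k A) \<le> D' * packing_premeasure \<psi>"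
    using \<open>0 < D'\<close> D'(2) by (simp add: ennreal_times_divide mult_divide_eq_ennreal mult.commute[of D'])
qed

lemma emeasure_le_packing_measure:
  assumes \<psi>: "\<psi> \<in> hausdorff_functions" and D: "0 < lower_dens \<psi>" "lower_dens \<psi> < \<infinity>"
    and X: "X \<subseteq> K" "X \<in> sets \<mu>"
  shows "emeasure \<mu> X \<le> lower_dens \<psi> * Metric_space.packing_measure X seq_dist \<psi>"
proof -
  interpret Metric_space X seq_dist
    using X(1) by (rule Metric_space_subset_K)
  have "emeasure \<mu> X / lower_dens \<psi> \<le> (\<Sum>i. Metric_space.packing_premeasure (A i) seq_dist \<psi>)"
    if XA: "X = (\<Union>i. A i)" for A :: "nat \<Rightarrow> (nat \<Rightarrow> nat) set"
  proof (rule divide_le_posI_ennreal[OF D(1)])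
    have A: "A i \<subseteq> K" for i
      using XA X(1) by blast
    have sets_cl: "(\<Inter>k. nbhd k (A i)) \<in> sets \<mu>" for i
      using sets_nbhd[OF A] by (intro sets.countable_INT) auto
    have "X \<subseteq> (\<Union>i. \<Inter>k. nbhd k (A i))"
      using subset_nbhd[OF A] unfolding XA by blast
    then have "emeasure \<mu> X \<le> emeasure \<mu> (\<Union>i. \<Inter>k. nbhd k (A i))"
      using sets_cl by (intro emeasure_mono) auto
    also have "\<dots> \<le> (\<Sum>i. emeasure \<mu> (\<Inter>k. nbhd k (A i)))"
      using sets_cl by (intro emeasure_subadditive_countably) auto
    also have "\<dots> \<le> (\<Sum>i. lower_dens \<psi> * Metric_space.packing_premeasure (A i) seq_dist \<psi>)"
      by (intro suminf_le emeasure_le_packing_premeasure[OF \<psi> D A]) auto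
    finally show "emeasure \<mu> X \<le> lower_dens \<psi> * (\<Sum>i. Metric_space.packing_premeasure (A i) seq_dist \<psi>)"
      by simp
  qed
  then have "emeasure \<mu> X / lower_dens \<psi> \<le> packing_measure \<psi>"
    unfolding packing_measure_def by (intro INF_greatest) auto
  then have "lower_dens \<psi> * (emeasure \<mu> X / lower_dens \<psi>) \<le> lower_dens \<psi> * packing_measure \<psi>"
    by (rule mult_left_mono) simp
  then show ?thesis
    using D by (simp add: ennreal_times_divide mult_divide_eq_ennreal mult.commute[of "lower_dens \<psi>"])
qed

text \<open>The passage from neighbourhoods to Borel sets, common to Hausdorff measure, where
  \<open>\<nu>' = \<nu>\<close>, and packing measure, where \<open>\<nu>'\<close> is the premeasure: a cylinder of level \<open>k\<close> contains the
  level-\<open>k\<close> neighbourhood of each of its subsets.\<close>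

lemma mult_le_emeasure_of_subadditive:
  fixes \<nu> \<nu>' :: "(nat \<Rightarrow> nat) set \<Rightarrow> ennreal"
  assumes sub: "\<And>A :: nat \<Rightarrow> (nat \<Rightarrow> nat) set. X = (\<Union>i. A i) \<Longrightarrow> \<nu> X \<le> (\<Sum>i. \<nu>' (A i))"
    and nbhd: "\<And>A k. A \<subseteq> K \<Longrightarrow> D * \<nu>' A \<le> emeasure \<mu> (nbhd k A)"
    and X: "X \<in> sigma_sets K {cyl k x |k x. x \<in> K}"
  shows "D * \<nu> X \<le> emeasure \<mu> X"
proof (rule ennreal_le_epsilon)
  fix e :: real assume "0 < e"
  obtain C :: "nat \<Rightarrow> (nat \<Rightarrow> nat) set" where
    C: "\<And>i. C i = {} \<or> (\<exists>k. \<exists>x\<in>K. C i = cyl k x)" "X \<subseteq> (\<Union>i. C i)"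
      "(\<Sum>i. emeasure \<mu> (C i)) \<le> emeasure \<mu> X + ennreal e"
    by (rule ex_cylinder_cover[OF X \<open>0 < e\<close>]) (rule that)
  have le: "D * \<nu>' (X \<inter> C i) \<le> emeasure \<mu> (C i)" for i
  proof (cases "C i = {}")
    case True
    then show ?thesis using nbhd[of "{}" 0] by (simp add: nbhd_def)
  next
    case False
    then obtain k x where kx: "x \<in> K" "C i = cyl k x"
      using C(1)[of i] by blast
    have "X \<inter> C i \<subseteq> K"
      using cyl_subset_K kx(2) by blast
    then have "D * \<nu>' (X \<inter> C i) \<le> emeasure \<mu> (nbhd k (X \<inter> C i))"
      by (rule nbhd)
    also have "\<dots> \<le> emeasure \<mu> (C i)"
      unfolding kx(2) using kx(1) by (intro emeasure_mono nbhd_subset_cyl sets_cyl) auto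
    finally show ?thesis .
  qed
  have "D * \<nu> X \<le> D * (\<Sum>i. \<nu>' (X \<inter> C i))"
    using C(2) by (intro mult_left_mono sub) auto
  also have "\<dots> = (\<Sum>i. D * \<nu>' (X \<inter> C i))"
    by simp
  also have "\<dots> \<le> (\<Sum>i. emeasure \<mu> (C i))"
    using le by (intro suminf_le) auto
  also note C(3)
  finally show "D * \<nu> X \<le> emeasure \<mu> X + ennreal e" .
qed

lemma borel_subsets_D:
  assumes "X \<in> Metric_space.borel_subsets K seq_dist"
  shows "X \<subseteq> K" "X \<in> sets \<mu>"
proof -
  show "X \<in> sets \<mu>"
    using borel_subset_sigma_cyls[OF assms] sigma_cyls_sets by blast
  then show "X \<subseteq> K"
    using sets.sets_into_space space_state by blast
qed

theorem hausdorff_measure_eq_emeasure: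
  assumes \<phi>: "\<phi> \<in> hausdorff_functions" and D: "0 < upper_dens \<phi>" "upper_dens \<phi> < \<infinity>"
    and X: "X \<in> Metric_space.borel_subsets K seq_dist"
  shows "upper_dens \<phi> * Metric_space.hausdorff_measure X seq_dist \<phi> = emeasure \<mu> X"
proof (rule antisym)
  have metric: "Metric_space X seq_dist"
    using borel_subsets_D(1)[OF X] by (rule Metric_space_subset_K)
  show "upper_dens \<phi> * Metric_space.hausdorff_measure X seq_dist \<phi> \<le> emeasure \<mu> X"
    by (rule mult_le_emeasure_of_subadditive[where \<nu> = "\<lambda>X. Metric_space.hausdorff_measure X seq_dist \<phi>",
          OF Metric_space.hausdorff_measure_countably_subadditive[OF metric] hausdorff_measure_le_nbhd[OF \<phi>]
            borel_subset_sigma_cyls[OF X]])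
  show "emeasure \<mu> X \<le> upper_dens \<phi> * Metric_space.hausdorff_measure X seq_dist \<phi>"
    using emeasure_le_hausdorff_measure[OF \<phi> D borel_subsets_D[OF X]] .
qed

theorem packing_measure_eq_emeasure:
  assumes \<psi>: "\<psi> \<in> hausdorff_functions" and D: "0 < lower_dens \<psi>" "lower_dens \<psi> < \<infinity>"
    and X: "X \<in> Metric_space.borel_subsets K seq_dist"
  shows "lower_dens \<psi> * Metric_space.packing_measure X seq_dist \<psi> = emeasure \<mu> X"
proof (rule antisym)
  have metric: "Metric_space X seq_dist"
    using borel_subsets_D(1)[OF X] by (rule Metric_space_subset_K)
  show "lower_dens \<psi> * Metric_space.packing_measure X seq_dist \<psi> \<le> emeasure \<mu> X"
    by (rule mult_le_emeasure_of_subadditive[where \<nu> = "\<lambda>X. Metric_space.packing_measure X seq_dist \<psi>",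
          OF Metric_space.packing_measure_le_suminf[OF metric] packing_premeasure_le_nbhd[OF \<psi>]
            borel_subset_sigma_cyls[OF X]])
  show "emeasure \<mu> X \<le> lower_dens \<psi> * Metric_space.packing_measure X seq_dist \<psi>"
    using emeasure_le_packing_measure[OF \<psi> D borel_subsets_D[OF X]] .
qed

end

theorem theorem2p1:
  fixes \<phi> \<psi> :: "real \<Rightarrow> real"
  assumes "\<phi> \<in> hausdorff_functions" and "\<psi> \<in> hausdorff_functions"
    and "\<exists>C>0. \<forall>\<epsilon>>0. \<psi> (2 * \<epsilon>) \<le> C * \<phi> \<epsilon>"
  shows "\<exists>n K \<mu>. compact_product n K \<and> \<mu> = equilibrium_state n \<and>
    (\<exists>D\<^sub>\<phi> D\<^sub>\<psi> :: ennreal.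
      (\<forall>x\<in>K. Metric_space.upper_density K seq_dist \<mu> \<phi> x = D\<^sub>\<phi>) \<and>
      (\<forall>x\<in>K. Metric_space.lower_density K seq_dist \<mu> \<psi> x = D\<^sub>\<psi>) \<and>
      (\<forall>X\<in>Metric_space.borel_subsets K seq_dist.
         D\<^sub>\<phi> * Metric_space.hausdorff_measure X seq_dist \<phi> = emeasure \<mu> X \<and>
         emeasure \<mu> X = D\<^sub>\<psi> * Metric_space.packing_measure X seq_dist \<psi>) \<and>
      D\<^sub>\<phi> * Metric_space.hausdorff_measure K seq_dist \<phi> = 1 \<and>
      1 = D\<^sub>\<psi> * Metric_space.packing_measure K seq_dist \<psi>)"
proof -
  from assms(3) obtain C where C: "0 < C" "\<And>\<epsilon>. 0 < \<epsilon> \<Longrightarrow> \<psi> (2 * \<epsilon>) \<le> C * \<phi> \<epsilon>"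
    by blast
  note \<phi> = assms(1) and \<psi> = assms(2)
  define a where "a k = 1 / \<phi> (1 / 2 ^ Suc k)" for k
  define b where "b k = C / \<psi> (1 / 2 ^ k)" for k
  have ab: "a k \<le> b k" for k
  proof -
    have "\<psi> (1 / 2 ^ k) \<le> C * \<phi> (1 / 2 ^ Suc k)"
      using C(2)[of "1 / 2 ^ Suc k"] by simp
    moreover have "0 < \<phi> (1 / 2 ^ Suc k)" "0 < \<psi> (1 / 2 ^ k)"
      by (auto intro!: hausdorff_function_pos[OF \<phi>] hausdorff_function_pos[OF \<psi>])
    ultimately show ?thesis
      by (simp add: a_def b_def field_simps)
  qed
  have a_top: "filterlim a at_top sequentially"
  proof -
    have "(\<lambda>k. 1 / 2 ^ Suc k :: real) \<longlonglongrightarrow> 0"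
      using LIMSEQ_Suc[OF LIMSEQ_power_zero[of "1 / 2 :: real"]] by (simp add: power_one_over)
    then have "filterlim (\<lambda>k. 1 / 2 ^ Suc k :: real) (at_right 0) sequentially"
      by (simp add: filterlim_at_right_to_0 filterlim_at)
    then have "(\<lambda>k. \<phi> (1 / 2 ^ Suc k)) \<longlonglongrightarrow> \<phi> 0"
      by (rule filterlim_compose[OF hausdorff_function_tendsto[OF \<phi> order_refl]])
    moreover have "\<phi> 0 = 0"
      using \<phi> by (simp add: hausdorff_functions_def)
    ultimately have "filterlim (\<lambda>k. inverse (\<phi> (1 / 2 ^ Suc k))) at_top sequentially"
      by (intro filterlim_inverse_at_top) (auto intro!: always_eventually hausdorff_function_pos[OF \<phi>])
    then show ?thesis
      by (simp add: a_def[abs_def] inverse_eq_divide)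
  qed
  have b_mono: "incseq b"
  proof (rule incseq_SucI)
    fix k
    have "\<psi> (1 / 2 ^ Suc k) \<le> \<psi> (1 / 2 ^ k)"
      by (rule hausdorff_function_mono[OF \<psi>]) (auto simp: divide_simps)
    moreover have "0 < \<psi> (1 / 2 ^ Suc k)"
      by (rule hausdorff_function_pos[OF \<psi>]) simp
    ultimately show "b k \<le> b (Suc k)"
      using C(1) unfolding b_def by (intro divide_left_mono) auto
  qed
  obtain n :: "nat \<Rightarrow> nat" where n: "\<And>k. 1 \<le> n k"
    "\<forall>\<^sub>F k in sequentially. a k \<le> 2 * (\<Prod>i=1..k. real (n i))"
    "\<exists>\<^sub>F k in sequentially. (\<Prod>i=1..k. real (n i)) \<le> 2 * a k"
    "\<forall>\<^sub>F k in sequentially. (\<Prod>i=1..k. real (n i)) \<le> 2 * b k"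
    "\<exists>\<^sub>F k in sequentially. b k \<le> 2 * (\<Prod>i=1..k. real (n i))"
    using ex_interpolating_products[of a b, OF ab a_top b_mono] by blast
  interpret cylinders n
    by unfold_locales (rule n(1))
  \<comment> \<open>The lower barrier controls the upper density of \<open>\<phi>\<close>, and the upper barrier the lower density
    of \<open>\<psi>\<close>.\<close>
  have "upper_dens \<phi> \<le> ennreal 2"
    using n(2) by (intro upper_dens_le[OF \<phi>]) (simp_all add: a_def)
  moreover have "ennreal (1 / 2 / 2) \<le> upper_dens \<phi>"
  proof (rule upper_dens_ge[OF \<phi>])
    show "\<exists>\<^sub>F k in sequentially. 1 / 2 * (\<Prod>i=1..k. real (n i)) \<le> 1 / \<phi> (1 / 2 ^ Suc k)"
      using n(3) by (rule frequently_elim1) (simp add: a_def)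
  qed simp
  ultimately have D\<^sub>\<phi>: "0 < upper_dens \<phi>" "upper_dens \<phi> < \<infinity>"
    by (auto intro: less_le_trans[rotated] le_less_trans)
  have "lower_dens \<psi> \<le> ennreal (2 / C)"
  proof (rule lower_dens_le[OF \<psi>])
    show "\<exists>\<^sub>F k in sequentially. 1 / \<psi> (1 / 2 ^ k) \<le> 2 / C * (\<Prod>i=1..k. real (n i))"
      using n(5) C(1) by (rule_tac frequently_elim1) (auto simp: b_def field_simps)
  qed (use C(1) in simp)
  moreover have "ennreal (1 / (2 * C)) \<le> lower_dens \<psi>"
  proof (rule lower_dens_ge[OF \<psi>])
    show "\<forall>\<^sub>F k in sequentially. 1 / (2 * C) * (\<Prod>i=1..k. real (n i)) \<le> 1 / \<psi> (1 / 2 ^ k)"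
      using n(4)
    proof (rule eventually_mono)
      fix k assume "(\<Prod>i=1..k. real (n i)) \<le> 2 * b k"
      then have "1 / (2 * C) * (\<Prod>i=1..k. real (n i)) \<le> 1 / (2 * C) * (2 * b k)"
        using C(1) by (intro mult_left_mono) auto
      then show "1 / (2 * C) * (\<Prod>i=1..k. real (n i)) \<le> 1 / \<psi> (1 / 2 ^ k)"
        using C(1) by (simp add: b_def)
    qed
  qed (use C(1) in simp)
  ultimately have D\<^sub>\<psi>: "0 < lower_dens \<psi>" "lower_dens \<psi> < \<infinity>"
    using C(1) by (auto intro: less_le_trans[rotated] le_less_trans)
  note H = hausdorff_measure_eq_emeasure[OF \<phi> D\<^sub>\<phi>] and P = packing_measure_eq_emeasure[OF \<psi> D\<^sub>\<psi>]
  have K: "K \<in> Metric_space.borel_subsets K seq_dist"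
    unfolding Metric_space.borel_subsets_def[OF Metric_space_subset_K[OF order_refl]]
    by (rule sigma_sets_top)
  have \<mu>_K: "emeasure \<mu> K = 1"
    using prob_space.emeasure_space_1[OF prob_space_state] by (simp add: space_state)
  show ?thesis
  proof (intro exI conjI ballI)
    show "compact_product n K"
      by (rule compact_product_K)
    show "\<mu> = equilibrium_state n" ..
    show "upper_dens \<phi> * Metric_space.hausdorff_measure K seq_dist \<phi> = 1"
      using H[OF K] \<mu>_K by simp
    show "1 = lower_dens \<psi> * Metric_space.packing_measure K seq_dist \<psi>"
      using P[OF K] \<mu>_K by simp
  next
    fix x assume "x \<in> K"
    then show "Metric_space.upper_density K seq_dist \<mu> \<phi> x = upper_dens \<phi>"
      and "Metric_space.lower_density K seq_dist \<mu> \<psi> x = lower_dens \<psi>"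
      by (rule upper_density_eq, rule lower_density_eq)
  next
    fix X assume X: "X \<in> Metric_space.borel_subsets K seq_dist"
    show "upper_dens \<phi> * Metric_space.hausdorff_measure X seq_dist \<phi> = emeasure \<mu> X"
      using H[OF X] .
    show "emeasure \<mu> X = lower_dens \<psi> * Metric_space.packing_measure X seq_dist \<psi>"
      using P[OF X] ..
  qed
qed

end
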